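(* Let $u:\mathbb{D}\to\mathbb{D}$ be a $T_2$-harmonic function. Then for all $z\in\mathbb{D}$, $$\left|u(z)-\frac{(1-|z|^2)^3}{(1+|z|^2)^2}\,u(0)\right|\leq \frac{2}{\pi}\left[(1+|z|^2)\arctan |z|+ \frac{|z|(1-|z|^2)}{1+|z|^2}\right].$$
   Context: $\mathbb{D}=\{z\in\mathbb{C}:|z|<1\}$ is the open unit disk. For $\alpha\in\mathbb{R}$, a complex-valued function $u\in\mathcal{C}^2(\mathbb{D})$ (twice continuously differentiable) is called $T_\alpha$-harmonic if $T_\alpha(u)=0$ in $\mathbb{D}$, where $$T_\alpha=-\frac{\alpha^2}{4}(1-|z|^2)^{-(\alpha+1)}+\frac12 L_\alpha+\frac12\overline{L_\alpha},\qquad L_\alpha=\frac{\partial}{\partial\overline z}(1-|z|^2)^{-\alpha}\frac{\partial}{\partial z},\qquad \overline{L_\alpha}=\frac{\partial}{\partial z}(1-|z|^2)^{-\alpha}\frac{\partial}{\partial \overline z},$$ with $\frac{\partial}{\partial z}=\frac12(\partial_x-i\partial_y)$ and $\frac{\partial}{\partial\overline z}=\frac12(\partial_x+i\partial_y)$ for $z=x+iy$; the first term of $T_\alpha$ is multiplication by the given function. $T_2$-harmonic means the case $\alpha=2$. Functions are complex-valued. *)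

theory Defs
  imports "HOL-Analysis.Analysis"
begin

abbreviation unit_disk :: "complex set" where
  "unit_disk \<equiv> ball 0 1"

text \<open>The partial derivatives in the real variables x and y, where z = x + iy: the real
  Frechet derivative applied to the directions 1 and i.\<close>

definition dx :: "(complex \<Rightarrow> complex) \<Rightarrow> complex \<Rightarrow> complex" where
  "dx f z = frechet_derivative f (at z) 1"

definition dy :: "(complex \<Rightarrow> complex) \<Rightarrow> complex \<Rightarrow> complex" where
  "dy f z = frechet_derivative f (at z) \<i>"

text \<open>Differentiability here is over the reals, not complex differentiability. The two
  predicates are meant for open sets.\<close>

definition C1_on :: "complex set \<Rightarrow> (complex \<Rightarrow> complex) \<Rightarrow> bool" where
  "C1_on S f \<longleftrightarrow>
     (\<forall>z\<in>S. f differentiable (at z)) \<and> continuous_on S (dx f) \<and> continuous_on S (dy f)"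

definition C2_on :: "complex set \<Rightarrow> (complex \<Rightarrow> complex) \<Rightarrow> bool" where
  "C2_on S f \<longleftrightarrow> C1_on S f \<and> C1_on S (dx f) \<and> C1_on S (dy f)"

definition wirtinger :: "(complex \<Rightarrow> complex) \<Rightarrow> complex \<Rightarrow> complex" where
  "wirtinger f z = (dx f z - \<i> * dy f z) / 2"

definition wirtinger_bar :: "(complex \<Rightarrow> complex) \<Rightarrow> complex \<Rightarrow> complex" where
  "wirtinger_bar f z = (dx f z + \<i> * dy f z) / 2"

definition L_op :: "real \<Rightarrow> (complex \<Rightarrow> complex) \<Rightarrow> complex \<Rightarrow> complex" where
  "L_op \<alpha> u =
     wirtinger_bar (\<lambda>w. of_real ((1 - (cmod w)\<^sup>2) powr (-\<alpha>)) * wirtinger u w)"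

definition L_bar_op :: "real \<Rightarrow> (complex \<Rightarrow> complex) \<Rightarrow> complex \<Rightarrow> complex" where
  "L_bar_op \<alpha> u =
     wirtinger (\<lambda>w. of_real ((1 - (cmod w)\<^sup>2) powr (-\<alpha>)) * wirtinger_bar u w)"

definition T_op :: "real \<Rightarrow> (complex \<Rightarrow> complex) \<Rightarrow> complex \<Rightarrow> complex" where
  "T_op \<alpha> u z =
     - of_real (\<alpha>\<^sup>2 / 4 * (1 - (cmod z)\<^sup>2) powr (-(\<alpha> + 1))) * u z
     + L_op \<alpha> u z / 2 + L_bar_op \<alpha> u z / 2"

text \<open>Only the values of u on the unit disk matter, since the disk is open.\<close>

definition T_harmonic :: "real \<Rightarrow> (complex \<Rightarrow> complex) \<Rightarrow> bool" where
  "T_harmonic \<alpha> u \<longleftrightarrow> C2_on unit_disk u \<and> (\<forall>z\<in>unit_disk. T_op \<alpha> u z = 0)"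

end

theory Submission
  imports Defs
begin

text \<open>
  Write \<open>r = |z|\<close>. Multiplied by \<open>(1 - r\<^sup>2)\<^sup>3\<close>, the equation \<open>T\<^sub>2 u = 0\<close> becomes
  \<open>(1 - r\<^sup>2)/4 \<Delta>u + x u\<^sub>x + y u\<^sub>y - u = 0\<close>. Two features carry the proof. The coefficient of
  \<open>u\<close> itself is negative, so the maximum principle holds for the modulus of complex solutions
  (\<open>T2_maximum_principle\<close>). And separation of variables gives polynomials: the solution that equals
  \<open>e\<^bsup>int\<^esup>\<close> on the unit circle is \<open>\<phi>\<^sub>n(r) e\<^bsup>int\<^esup>\<close> with
  \<open>\<phi>\<^sub>n(r) = r\<^bsup>n\<^esup> ((n + 1) - (n - 1) r\<^sup>2) / 2\<close> for \<open>n \<ge> 0\<close>, and its conjugate belongs to \<open>-n\<close>.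

  Fix \<open>\<rho> < 1\<close>. Trigonometric polynomials approximate \<open>u\<close> uniformly on the circle of radius \<open>\<rho>\<close>; each
  of them extends to a combination of these solutions, and by the maximum principle the approximation
  persists inside the circle. For the extensions, the value at a point is the integral of the
  boundary values against the kernel with Fourier coefficients \<open>\<phi>\<^sub>n(r) / \<phi>\<^sub>n(\<rho>)\<close>; hence the same
  formula holds for \<open>u\<close> (\<open>T2_solution_reproducing\<close>). Since \<open>u\<close> need not extend
  to the unit circle, \<open>\<rho>\<close> stays below 1 until only kernels are left.

  Put \<open>k = (1 - r\<^sup>2)\<^sup>3 / (1 + r\<^sup>2)\<^sup>2\<close>. Subtracting \<open>k\<close> times the formula at the origin from that at \<open>z\<close>,
  and using \<open>|u| \<le> 1\<close>, bounds \<open>2\<pi> |u(z) - k u(0)|\<close> by the integral of the modulus of the difference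
  of kernels. As \<open>\<rho> \<rightarrow> 1\<close>, dominated convergence of the Fourier series replaces the kernel at \<open>z\<close>
  by \<open>(1 - r\<^sup>2)\<^sup>3 / (2 (1 + r\<^sup>2 - 2 r cos \<theta>)\<^sup>2)\<close> and the kernel at the origin by \<open>1/2\<close>
  (\<open>radial_factor_quotient_tendsto\<close>, \<open>cosine_kernel_radial_factor\<close>). The constant \<open>k\<close> is exactly
  such that the difference changes sign where \<open>cos \<theta> = 0\<close>, and an elementary primitive evaluates
  the integral of its modulus to the asserted bound (\<open>kernel_deviation_integral\<close>).
\<close>

section \<open>The differential equation\<close>

definition has_dir_deriv :: "(complex \<Rightarrow> complex) \<Rightarrow> complex \<Rightarrow> complex \<Rightarrow> complex \<Rightarrow> bool" where
  "has_dir_deriv f v z d \<longleftrightarrow> ((\<lambda>t. f (z + t *\<^sub>R v)) has_vector_derivative d) (at 0)"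

lemma has_dir_deriv_along_line:
  assumes "has_dir_deriv f v (z + s *\<^sub>R v) d"
  shows "((\<lambda>t. f (z + t *\<^sub>R v)) has_vector_derivative d) (at s)"
proof -
  define g where "g = (\<lambda>t. f ((z + s *\<^sub>R v) + t *\<^sub>R v))"
  have "(g has_vector_derivative d) (at (s - s))"
    using assms by (simp add: has_dir_deriv_def g_def)
  moreover have "((\<lambda>t. t - s) has_real_derivative 1) (at s)"
    by (auto intro!: derivative_eq_intros)
  ultimately have "((g \<circ> (\<lambda>t. t - s)) has_vector_derivative (1 *\<^sub>R d)) (at s)"
    by (intro vector_diff_chain_at) (auto simp: has_real_derivative_iff_has_vector_derivative)
  moreover have "g \<circ> (\<lambda>t. t - s) = (\<lambda>t. f (z + t *\<^sub>R v))"
    by (simp add: g_def fun_eq_iff scaleR_diff_left)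
  ultimately show ?thesis by simp
qed

lemma has_dir_deriv_of_has_derivative:
  assumes "(f has_derivative D) (at z)"
  shows "has_dir_deriv f v z (D v)"
proof -
  have "((\<lambda>t::real. z + t *\<^sub>R v) has_vector_derivative v) (at 0)"
    by (auto intro!: derivative_eq_intros)
  then have "((f \<circ> (\<lambda>t. z + t *\<^sub>R v)) has_vector_derivative D v) (at 0)"
    using assms by (intro vector_derivative_diff_chain_within) (auto intro: has_derivative_at_withinI)
  then show ?thesis by (simp add: has_dir_deriv_def o_def)
qed

lemma has_dir_deriv_lincomb:
  assumes "has_dir_deriv f v z d" "has_dir_deriv g v z e"
  shows "has_dir_deriv (\<lambda>w. a * f w + b * g w) v z (a * d + b * e)"
  using assms unfolding has_dir_deriv_def
  by (intro has_vector_derivative_add has_vector_derivative_mult_right)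

lemma has_dir_deriv_cnj:
  assumes "has_dir_deriv f v z d"
  shows "has_dir_deriv (\<lambda>w. cnj (f w)) v z (cnj d)"
  using assms unfolding has_dir_deriv_def by (rule has_vector_derivative_cnj)

text \<open>The equation \<open>T\<^sub>2 f = 0\<close> after clearing the weight. The derivatives are supplied as witnesses
  along the coordinate lines, the form in which the second derivative test consumes them; this also
  makes closure under linear combinations and conjugation immediate.\<close>

definition T2_equation_at where
  "T2_equation_at f fx fy fxx fyy z \<longleftrightarrow>
     has_dir_deriv f 1 z (fx z) \<and> has_dir_deriv f \<i> z (fy z) \<and>
     has_dir_deriv fx 1 z (fxx z) \<and> has_dir_deriv fy \<i> z (fyy z) \<and>
     of_real ((1 - (cmod z)\<^sup>2) / 4) * (fxx z + fyy z)
       + of_real (Re z) * fx z + of_real (Im z) * fy z = f z"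

definition T2_solution :: "(complex \<Rightarrow> complex) \<Rightarrow> bool" where
  "T2_solution f \<longleftrightarrow> continuous_on unit_disk f \<and>
     (\<exists>fx fy fxx fyy. \<forall>z\<in>unit_disk. T2_equation_at f fx fy fxx fyy z)"

lemma T2_solutionI:
  assumes "continuous_on unit_disk f"
    and "\<And>z. z \<in> unit_disk \<Longrightarrow> T2_equation_at f fx fy fxx fyy z"
  shows "T2_solution f"
  using assms unfolding T2_solution_def by blast

lemma T2_solutionE:
  assumes "T2_solution f"
  obtains fx fy fxx fyy where "continuous_on unit_disk f"
    and "\<And>z. z \<in> unit_disk \<Longrightarrow> T2_equation_at f fx fy fxx fyy z"
  using assms unfolding T2_solution_def by blast

text \<open>The equation is linear with real coefficients, hence closed under complex linear combinations
  and conjugation.\<close>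

lemma T2_solution_lincomb:
  assumes "T2_solution f" "T2_solution g"
  shows "T2_solution (\<lambda>z. a * f z + b * g z)"
proof -
  obtain fx fy fxx fyy where cf: "continuous_on unit_disk f"
    and f: "\<And>z. z \<in> unit_disk \<Longrightarrow> T2_equation_at f fx fy fxx fyy z"
    using T2_solutionE[OF assms(1)] by blast
  obtain gx gy gxx gyy where cg: "continuous_on unit_disk g"
    and g: "\<And>z. z \<in> unit_disk \<Longrightarrow> T2_equation_at g gx gy gxx gyy z"
    using T2_solutionE[OF assms(2)] by blast
  have "T2_equation_at (\<lambda>z. a * f z + b * g z) (\<lambda>z. a * fx z + b * gx z)
      (\<lambda>z. a * fy z + b * gy z) (\<lambda>z. a * fxx z + b * gxx z) (\<lambda>z. a * fyy z + b * gyy z) z"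
    if "z \<in> unit_disk" for z
  proof -
    define c where "c = complex_of_real ((1 - (cmod z)\<^sup>2) / 4)"
    have "a * f z + b * g z = a * (c * (fxx z + fyy z) + of_real (Re z) * fx z + of_real (Im z) * fy z)
       + b * (c * (gxx z + gyy z) + of_real (Re z) * gx z + of_real (Im z) * gy z)"
      using f[OF that] g[OF that] unfolding c_def T2_equation_at_def by simp
    then have "c * ((a * fxx z + b * gxx z) + (a * fyy z + b * gyy z))
          + of_real (Re z) * (a * fx z + b * gx z) + of_real (Im z) * (a * fy z + b * gy z)
        = a * f z + b * g z"
      by (simp add: algebra_simps)
    then show ?thesis
      using f[OF that] g[OF that] unfolding T2_equation_at_def c_def
      by (auto intro!: has_dir_deriv_lincomb)
  qed
  then show ?thesis using cf cg by (intro T2_solutionI continuous_intros)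
qed

lemma T2_solution_cnj:
  assumes "T2_solution f"
  shows "T2_solution (\<lambda>z. cnj (f z))"
proof -
  obtain fx fy fxx fyy where cf: "continuous_on unit_disk f"
    and f: "\<And>z. z \<in> unit_disk \<Longrightarrow> T2_equation_at f fx fy fxx fyy z"
    using T2_solutionE[OF assms(1)] by blast
  have "T2_equation_at (\<lambda>z. cnj (f z)) (\<lambda>z. cnj (fx z)) (\<lambda>z. cnj (fy z))
      (\<lambda>z. cnj (fxx z)) (\<lambda>z. cnj (fyy z)) z" if "z \<in> unit_disk" for z
  proof -
    have "cnj (of_real ((1 - (cmod z)\<^sup>2) / 4) * (fxx z + fyy z)
       + of_real (Re z) * fx z + of_real (Im z) * fy z) = cnj (f z)"
      using f[OF that] unfolding T2_equation_at_def by simp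
    then show ?thesis
      using f[OF that] unfolding T2_equation_at_def
      by (auto intro!: has_dir_deriv_cnj)
  qed
  then show ?thesis using cf by (intro T2_solutionI continuous_intros)
qed

lemma T2_solution_sum:
  assumes "finite A" "\<And>m. m \<in> A \<Longrightarrow> T2_solution (f m)"
  shows "T2_solution (\<lambda>z. \<Sum>m\<in>A. a m * f m z)"
  using assms
proof (induction A)
  case empty
  have "T2_solution (\<lambda>z. 0)"
    by (rule T2_solutionI[of _ "\<lambda>_. 0" "\<lambda>_. 0" "\<lambda>_. 0" "\<lambda>_. 0"])
      (auto simp: T2_equation_at_def has_dir_deriv_def)
  then show ?case by simp
next
  case (insert m A)
  then have "T2_solution (\<lambda>z. a m * f m z + 1 * (\<Sum>m\<in>A. a m * f m z))"
    by (intro T2_solution_lincomb) auto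
  with insert show ?case by simp
qed

section \<open>The maximum principle\<close>

lemma second_derivative_test_max:
  fixes g g' :: "real \<Rightarrow> real"
  assumes d: "d > 0"
    and g: "\<And>t. \<bar>t\<bar> < d \<Longrightarrow> (g has_real_derivative g' t) (at t)"
    and g2: "(g' has_real_derivative k) (at 0)"
    and max: "\<And>t. \<bar>t\<bar> < d \<Longrightarrow> g t \<le> g 0"
  shows "g' 0 = 0" "k \<le> 0"
proof -
  show g0: "g' 0 = 0"
    by (rule DERIV_local_max[OF g[of 0] d]) (use d max in auto)
  show "k \<le> 0"
  proof (rule ccontr)
    assume "\<not> k \<le> 0"
    then obtain e where e: "e > 0" "\<And>h. h > 0 \<Longrightarrow> h < e \<Longrightarrow> g' 0 < g' (0 + h)"
      using DERIV_pos_inc_right[OF g2] by auto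
    define t where "t = min e d / 2"
    have t: "0 < t" "t < e" "t < d" using e(1) d by (auto simp: t_def)
    have "\<exists>\<xi>>0. \<xi> < t \<and> g t - g 0 = (t - 0) * g' \<xi>"
      by (rule MVT2) (use t in \<open>auto intro: g\<close>)
    then obtain \<xi> where \<xi>: "0 < \<xi>" "\<xi> < t" "g t - g 0 = t * g' \<xi>" by auto
    have "g' \<xi> > 0" using e(2)[of \<xi>] \<xi> t g0 by auto
    then have "g t - g 0 > 0" using \<xi> t by simp
    then show False using max[of t] t by auto
  qed
qed

lemma dir_derivs_at_max:
  assumes z: "ball z \<delta> \<subseteq> S" and \<delta>: "\<delta> > 0" and v: "norm v = 1"
    and f: "\<And>w. w \<in> S \<Longrightarrow> has_dir_deriv f v w (fv w)"
    and f2: "has_dir_deriv fv v z fvv"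
    and max: "\<And>w. w \<in> ball z \<delta> \<Longrightarrow> Re (c * f w) \<le> Re (c * f z)"
  shows "Re (c * fv z) = 0" "Re (c * fvv) \<le> 0"
proof -
  define g where "g = (\<lambda>t. Re (c * f (z + t *\<^sub>R v)))"
  define g' where "g' = (\<lambda>t. Re (c * fv (z + t *\<^sub>R v)))"
  have Rec: "((\<lambda>t. Re (c * h t)) has_real_derivative Re (c * d)) (at t)"
    if "(h has_vector_derivative d) (at t)" for h d t
    unfolding has_real_derivative_iff_has_vector_derivative
    using bounded_linear.has_vector_derivative
      [OF bounded_linear_compose[OF bounded_linear_Re bounded_linear_mult_right[of c]] that] .
  have inb: "z + t *\<^sub>R v \<in> ball z \<delta>" if "\<bar>t\<bar> < \<delta>" for t
    using that v by (simp add: dist_norm)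
  have 1: "(g has_real_derivative g' t) (at t)" if "\<bar>t\<bar> < \<delta>" for t
    unfolding g_def g'_def
    by (intro Rec has_dir_deriv_along_line f) (use inb[OF that] z in auto)
  have 2: "(g' has_real_derivative Re (c * fvv)) (at 0)"
    unfolding g'_def by (intro Rec has_dir_deriv_along_line) (use f2 in simp)
  have 3: "g t \<le> g 0" if "\<bar>t\<bar> < \<delta>" for t
    using max[OF inb[OF that]] by (simp add: g_def)
  show "Re (c * fv z) = 0" "Re (c * fvv) \<le> 0"
    using second_derivative_test_max[OF \<delta> 1 2 3] by (auto simp: g'_def)
qed

text \<open>At an interior maximum \<open>z\<^sub>0\<close> of \<open>|f|\<close>, rotate so that \<open>c f(z\<^sub>0) = |f(z\<^sub>0)|\<close> with \<open>|c| = 1\<close>. Then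
  \<open>Re (c f)\<close> also has a maximum there: its gradient vanishes and its pure second derivatives are
  \<open>\<le> 0\<close>, so the equation gives \<open>|f(z\<^sub>0)| \<le> 0\<close>.\<close>

lemma T2_maximum_principle:
  assumes sol: "T2_solution f" and \<rho>: "0 < \<rho>" "\<rho> < 1"
    and bdry: "\<And>z. cmod z = \<rho> \<Longrightarrow> cmod (f z) \<le> M"
    and z: "cmod z \<le> \<rho>"
  shows "cmod (f z) \<le> M"
proof -
  obtain fx fy fxx fyy where cont: "continuous_on unit_disk f"
    and f: "\<And>z. z \<in> unit_disk \<Longrightarrow> T2_equation_at f fx fy fxx fyy z"
    using T2_solutionE[OF sol] by blast
  have sub: "cball 0 \<rho> \<subseteq> unit_disk" using \<rho> by auto
  have "continuous_on (cball 0 \<rho>) (\<lambda>z. cmod (f z))"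
    using continuous_on_subset[OF cont sub] by (intro continuous_intros)
  then obtain z0 where z0: "z0 \<in> cball 0 \<rho>" and
    max: "\<And>w. w \<in> cball 0 \<rho> \<Longrightarrow> cmod (f w) \<le> cmod (f z0)"
    using continuous_attains_sup[OF compact_cball, of 0 \<rho>] \<rho> by force
  have "cmod (f z0) \<le> M"
  proof (rule ccontr)
    assume neg: "\<not> cmod (f z0) \<le> M"
    have "cmod (f (of_real \<rho>)) \<le> M" by (rule bdry) (use \<rho> in auto)
    then have pos: "cmod (f z0) > 0" using neg norm_ge_zero[of "f (of_real \<rho>)"] by linarith
    have int: "cmod z0 < \<rho>" using z0 bdry[of z0] neg by force
    define \<delta> where "\<delta> = \<rho> - cmod z0"
    have \<delta>: "\<delta> > 0" using int by (simp add: \<delta>_def)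
    have ball: "ball z0 \<delta> \<subseteq> cball 0 \<rho>"
    proof
      fix w assume "w \<in> ball z0 \<delta>"
      then have "cmod (w - z0) < \<delta>" by (simp add: dist_norm norm_minus_commute)
      then have "cmod w < \<rho>" using norm_triangle_sub[of w z0] by (simp add: \<delta>_def)
      then show "w \<in> cball 0 \<rho>" by simp
    qed
    define c where "c = cnj (f z0) / of_real (cmod (f z0))"
    have c1: "cmod c = 1" using pos by (simp add: c_def norm_divide)
    have "f z0 * cnj (f z0) = of_real (cmod (f z0)) ^ 2"
      using complex_norm_square[of "f z0"] by simp
    then have cf: "c * f z0 = of_real (cmod (f z0))"
      using pos by (simp add: c_def power2_eq_square mult.commute)
    \<comment> \<open>Here \<open>Re (c f) \<le> |f|\<close> everywhere, with equality at \<open>z\<^sub>0\<close>.\<close>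
    have le: "Re (c * f w) \<le> Re (c * f z0)" if "w \<in> ball z0 \<delta>" for w
    proof -
      have "Re (c * f w) \<le> cmod (c * f w)" by (rule complex_Re_le_cmod)
      also have "\<dots> \<le> cmod (f z0)" using max[of w] that ball c1 by (auto simp: norm_mult)
      finally show ?thesis using cf by simp
    qed
    have z0d: "z0 \<in> unit_disk" using z0 sub by auto
    note D = f[OF z0d, unfolded T2_equation_at_def]
    have sb: "ball z0 \<delta> \<subseteq> unit_disk" using ball sub by auto
    have X: "Re (c * fx z0) = 0" "Re (c * fxx z0) \<le> 0"
      using dir_derivs_at_max[of z0 \<delta> unit_disk 1 f fx "fxx z0" c] f[unfolded T2_equation_at_def] D sb \<delta> le by auto
    have Y: "Re (c * fy z0) = 0" "Re (c * fyy z0) \<le> 0"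
      using dir_derivs_at_max[of z0 \<delta> unit_disk \<i> f fy "fyy z0" c] f[unfolded T2_equation_at_def] D sb \<delta> le by auto
    define a where "a = (1 - (cmod z0)\<^sup>2) / 4"
    have a: "a \<ge> 0" using z0d by (simp add: a_def abs_square_le_1 power_le_one)
    have "c * f z0 = of_real a * (c * fxx z0 + c * fyy z0)
        + of_real (Re z0) * (c * fx z0) + of_real (Im z0) * (c * fy z0)"
    proof -
      have "c * f z0 = c * (of_real a * (fxx z0 + fyy z0)
        + of_real (Re z0) * fx z0 + of_real (Im z0) * fy z0)"
        using D unfolding a_def by simp
      then show ?thesis by (simp add: algebra_simps)
    qed
    then have "Re (c * f z0) = a * (Re (c * fxx z0) + Re (c * fyy z0))
        + Re z0 * Re (c * fx z0) + Im z0 * Re (c * fy z0)"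
      by (simp only: plus_complex.sel Re_complex_of_real Im_complex_of_real
            times_complex.sel(1)[of "of_real _"] mult_zero_left diff_0_right)
    also have "\<dots> = a * (Re (c * fxx z0) + Re (c * fyy z0))" using X Y by simp
    also have "\<dots> \<le> 0" using a X Y by (intro mult_nonneg_nonpos) auto
    finally show False using cf pos by simp
  qed
  with max[of z] z show ?thesis by force
qed

section \<open>Reduction of the operator to the differential equation\<close>

text \<open>In \<open>L\<^sub>2/2\<close> plus its conjugate operator the mixed second derivatives cancel and leave the
  Laplacian; the derivatives of the weight \<open>(1 - |z|\<^sup>2)\<^bsup>-2\<^esup>\<close> produce the first-order terms.\<close>

lemma T2_solution_of_T_harmonic:
  assumes "T_harmonic 2 u"
  shows "T2_solution u"
proof -
  have diff: "u differentiable (at z)" "dx u differentiable (at z)" "dy u differentiable (at z)"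
    if "z \<in> unit_disk" for z
    using assms that by (auto simp: T_harmonic_def C2_on_def C1_on_def)
  have dir: "has_dir_deriv f 1 z (dx f z)" "has_dir_deriv f \<i> z (dy f z)"
    if "f differentiable (at z)" for f z
    using has_dir_deriv_of_has_derivative[OF that[unfolded frechet_derivative_works]]
    by (auto simp: dx_def dy_def)
  have eq: "of_real ((1 - (cmod z)\<^sup>2) / 4) * (dx (dx u) z + dy (dy u) z)
          + of_real (Re z) * dx u z + of_real (Im z) * dy u z = u z" if z: "z \<in> unit_disk" for z
  proof -
    define s where "s = 1 - (cmod z)\<^sup>2"
    have s: "s > 0" using z by (simp add: s_def abs_square_less_1 power_less_one_iff)
    define A where "A = frechet_derivative (dx u) (at z)"
    define B where "B = frechet_derivative (dy u) (at z)"
    have A: "(dx u has_derivative A) (at z)" and B: "(dy u has_derivative B) (at z)"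
      using diff[OF z] by (auto simp: A_def B_def frechet_derivative_works)
    define h where "h = (\<lambda>w. complex_of_real ((1 - (cmod w)\<^sup>2) powr (-2)))"
    have h': "(h has_derivative (\<lambda>v. of_real (4 * s powr (-3) * (z \<bullet> v)))) (at z)"
    proof -
      have "((\<lambda>w. 1 - (cmod w)\<^sup>2) has_derivative (\<lambda>v. - 2 * (z \<bullet> v))) (at z)"
        unfolding power2_norm_eq_inner
        by (rule derivative_eq_intros refl)+ (auto simp: inner_commute)
      moreover have "((\<lambda>x. x powr (-2)) has_real_derivative (-2) * s powr (-2 - 1)) (at (1 - (cmod z)\<^sup>2))"
        unfolding s_def[symmetric] using s by (rule has_real_derivative_powr)
      ultimately have "((\<lambda>w. (1 - (cmod w)\<^sup>2) powr (-2)) has_derivative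
          (\<lambda>v. (-2) * s powr (-2 - 1) * (- 2 * (z \<bullet> v)))) (at z)"
        using has_derivative_compose[where g="\<lambda>x. x powr (-2)"] unfolding has_field_derivative_def by blast
      then have "((\<lambda>w. (1 - (cmod w)\<^sup>2) powr (-2)) has_derivative
          (\<lambda>v. 4 * s powr (-3) * (z \<bullet> v))) (at z)"
        by (simp add: mult_ac)
      then show ?thesis unfolding h_def by (rule has_derivative_of_real)
    qed
    \<comment> \<open>Expresses all weights through \<open>(1 - |z|\<^sup>2)\<^bsup>-3\<^esup>\<close>, which can then be divided out.\<close>
    have hz: "h z = of_real (s * s powr (-3))"
      using s by (simp add: h_def s_def[symmetric] powr_mult_base)
    have dW: "((\<lambda>w. h w * wirtinger u w) has_derivative
       (\<lambda>v. h z * ((A v - \<i> * B v) / 2) + of_real (4 * s powr (-3) * (z \<bullet> v)) * wirtinger u z)) (at z)"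
      unfolding wirtinger_def
      by (rule has_derivative_mult[OF h'], rule derivative_eq_intros, (rule derivative_eq_intros A B refl)+) auto
    have dWb: "((\<lambda>w. h w * wirtinger_bar u w) has_derivative
       (\<lambda>v. h z * ((A v + \<i> * B v) / 2) + of_real (4 * s powr (-3) * (z \<bullet> v)) * wirtinger_bar u z)) (at z)"
      unfolding wirtinger_bar_def
      by (rule has_derivative_mult[OF h'], rule derivative_eq_intros, (rule derivative_eq_intros A B refl)+) auto
    define k where "k = complex_of_real (s powr (-3))"
    have k0: "k \<noteq> 0" using s by (simp add: k_def)
    define S where "S = complex_of_real s"
    define X where "X = complex_of_real (Re z)"
    define Y where "Y = complex_of_real (Im z)"
    have hz': "h z = S * k" by (simp add: hz S_def k_def)
    have L: "L_op 2 u z = ((S * k * ((A 1 - \<i> * B 1) / 2) + 4 * k * X * wirtinger u z)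
        + \<i> * (S * k * ((A \<i> - \<i> * B \<i>) / 2) + 4 * k * Y * wirtinger u z)) / 2"
    proof -
      define F where "F = (\<lambda>w. h w * wirtinger u w)"
      have "L_op 2 u z = wirtinger_bar F z" by (simp add: L_op_def F_def h_def)
      then show ?thesis
        using frechet_derivative_at[OF dW[folded F_def], symmetric]
        by (simp add: wirtinger_bar_def dx_def dy_def hz' k_def X_def Y_def inner_complex_def mult_ac)
    qed
    have Lb: "L_bar_op 2 u z = ((S * k * ((A 1 + \<i> * B 1) / 2) + 4 * k * X * wirtinger_bar u z)
        - \<i> * (S * k * ((A \<i> + \<i> * B \<i>) / 2) + 4 * k * Y * wirtinger_bar u z)) / 2"
    proof -
      define F where "F = (\<lambda>w. h w * wirtinger_bar u w)"
      have "L_bar_op 2 u z = wirtinger F z" by (simp add: L_bar_op_def F_def h_def)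
      then show ?thesis
        using frechet_derivative_at[OF dWb[folded F_def], symmetric]
        by (simp add: wirtinger_def dx_def dy_def hz' k_def X_def Y_def inner_complex_def mult_ac)
    qed
    have "0 = T_op 2 u z" using assms z by (simp add: T_harmonic_def)
    also have "\<dots> = - k * u z + L_op 2 u z / 2 + L_bar_op 2 u z / 2"
      by (simp add: T_op_def k_def s_def)
    also have "\<dots> = k * (S / 4 * (A 1 + B \<i>) + X * dx u z + Y * dy u z - u z)"
      unfolding L Lb wirtinger_def wirtinger_bar_def
      by (simp add: field_simps)
    finally have "S / 4 * (A 1 + B \<i>) + X * dx u z + Y * dy u z - u z = 0" using k0 by simp
    then show ?thesis
      by (simp add: S_def X_def Y_def A_def B_def dx_def dy_def s_def)
  qed
  have "continuous_on unit_disk u"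
    using diff(1) by (intro differentiable_imp_continuous_on) (auto simp: differentiable_on_def intro: differentiable_at_withinI)
  then show ?thesis
    using diff dir eq
    by (intro T2_solutionI[of u "dx u" "dy u" "dx (dx u)" "dy (dy u)"]) (auto simp: T2_equation_at_def)
qed

section \<open>Solutions of pure angular frequency\<close>

text \<open>The radial part \<open>\<phi>\<^sub>n\<close> of the solution with angular frequency \<open>n\<close>, normalised by \<open>\<phi>\<^sub>n(1) = 1\<close>.
  The subtraction \<open>n - 1\<close> is real, so that \<open>\<phi>\<^sub>0(r) = (1 + r\<^sup>2) / 2\<close>.\<close>

definition radial_factor :: "nat \<Rightarrow> real \<Rightarrow> real" where
  "radial_factor n r = r ^ n * ((real n + 1) - (real n - 1) * r\<^sup>2) / 2"

text \<open>The solution \<open>\<phi>\<^sub>n(r) e\<^bsup>int\<^esup>\<close> as a polynomial in \<open>z\<close> and its conjugate.\<close>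

definition power_solution :: "nat \<Rightarrow> complex \<Rightarrow> complex" where
  "power_solution n z = z ^ n * ((of_nat n + 1) - (of_nat n - 1) * (z * cnj z)) / 2"

text \<open>For \<open>f = z\<^bsup>n\<^esup> (a + b |z|\<^sup>2)\<close> one has \<open>\<Delta>f = 4 b (n + 1) z\<^bsup>n\<^esup>\<close> and
  \<open>x f\<^sub>x + y f\<^sub>y = n f + 2 b |z|\<^sup>2 z\<^bsup>n\<^esup>\<close>. In the equation the terms of order \<open>|z|\<^sup>2\<close> cancel, and the
  remaining condition \<open>(n + 1) b + (n - 1) a = 0\<close> fixes the ratio \<open>a : b = (n + 1) : -(n - 1)\<close>.\<close>

lemma T2_solution_power: "T2_solution (power_solution n)"
proof -
  define a where "a = (of_nat n + 1 :: complex)"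
  define b where "b = (1 - of_nat n :: complex)"
  define N where "N = (of_nat n :: complex)"
  define N' where "N' = (of_nat (n - 1) :: complex)"
  define R where "R = (\<lambda>z. a + b * (z * cnj z))"
  define fx where "fx = (\<lambda>z. (N * z ^ (n - 1) * R z + b * z ^ n * (cnj z + z)) / 2)"
  define fy where "fy = (\<lambda>z. \<i> * (N * z ^ (n - 1) * R z + b * z ^ n * (cnj z - z)) / 2)"
  define fxx where "fxx = (\<lambda>z. (N * N' * z ^ (n - 1 - 1) * R z
      + 2 * N * b * z ^ (n - 1) * (cnj z + z) + 2 * b * z ^ n) / 2)"
  define fyy where "fyy = (\<lambda>z. - (N * N' * z ^ (n - 1 - 1) * R z
      + 2 * N * b * z ^ (n - 1) * (cnj z - z) - 2 * b * z ^ n) / 2)"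
  have f: "power_solution n = (\<lambda>z. z ^ n * R z / 2)"
    by (simp add: fun_eq_iff power_solution_def R_def a_def b_def algebra_simps)
  have cont: "continuous_on unit_disk (power_solution n)"
    unfolding f R_def by (intro continuous_intros) auto
  have dcnj: "(cnj has_derivative cnj) F" for F
    using bounded_linear_imp_has_derivative[OF bounded_linear_cnj] .
  have dR: "(R has_derivative (\<lambda>v. b * (v * cnj z + z * cnj v))) (at z)" for z
    unfolding R_def by (rule derivative_eq_intros dcnj refl)+ (auto simp: algebra_simps)
  have dpow: "((\<lambda>z. z ^ k) has_derivative (\<lambda>v. of_nat k * z ^ (k - 1) * v)) (at z)" for k and z :: complex
    by (rule derivative_eq_intros refl)+ (auto simp: mult_ac)
  have df: "(power_solution n has_derivative
      (\<lambda>v. (N * z ^ (n - 1) * v * R z + z ^ n * (b * (v * cnj z + z * cnj v))) / 2)) (at z)" for z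
    unfolding f
    by (rule derivative_eq_intros dR dpow refl)+ (auto simp: N_def algebra_simps)
  have dfx: "(fx has_derivative
      (\<lambda>v. (N * N' * z ^ (n - 1 - 1) * v * R z + N * z ^ (n - 1) * (b * (v * cnj z + z * cnj v))
         + b * N * z ^ (n - 1) * v * (cnj z + z) + b * z ^ n * (cnj v + v)) / 2)) (at z)" for z
    unfolding fx_def
    by (rule derivative_eq_intros dcnj dR dpow refl)+ (auto simp: N_def N'_def algebra_simps)
  have dfy: "(fy has_derivative
      (\<lambda>v. \<i> * (N * N' * z ^ (n - 1 - 1) * v * R z + N * z ^ (n - 1) * (b * (v * cnj z + z * cnj v))
         + b * N * z ^ (n - 1) * v * (cnj z - z) + b * z ^ n * (cnj v - v)) / 2)) (at z)" for z
    unfolding fy_def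
    by (rule derivative_eq_intros dcnj dR dpow refl)+ (auto simp: N_def N'_def algebra_simps)
  have 1: "has_dir_deriv (power_solution n) 1 z (fx z)" for z
    using has_dir_deriv_of_has_derivative[OF df, of 1 z] by (simp add: fx_def algebra_simps)
  have 2: "has_dir_deriv (power_solution n) \<i> z (fy z)" for z
    using has_dir_deriv_of_has_derivative[OF df, of \<i> z] by (simp add: fy_def algebra_simps)
  have 3: "has_dir_deriv fx 1 z (fxx z)" for z
    using has_dir_deriv_of_has_derivative[OF dfx, of 1 z] by (simp add: fxx_def algebra_simps)
  have 4: "has_dir_deriv fy \<i> z (fyy z)" for z
    using has_dir_deriv_of_has_derivative[OF dfy, of \<i> z] by (simp add: fyy_def algebra_simps)
  have 5: "of_real ((1 - (cmod z)\<^sup>2) / 4) * (fxx z + fyy z)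
       + of_real (Re z) * fx z + of_real (Im z) * fy z = power_solution n z" for z
  proof -
    define w where "w = cnj z"
    have m: "complex_of_real ((1 - (cmod z)\<^sup>2) / 4) = (1 - z * w) / 4"
      using complex_norm_square[of z] by (simp add: w_def)
    have X: "of_real (Re z) = (z + w) / 2" and Y: "of_real (Im z) = (z - w) / (2 * \<i>)"
      by (simp_all add: w_def complex_eq_iff)
    define p where "p = N * z ^ (n - 1)"
    \<comment> \<open>Holds for \<open>n = 0\<close> too, as both sides vanish.\<close>
    have p: "p * z = N * z ^ n" by (cases n) (simp_all add: p_def N_def mult_ac)
    have L: "fxx z + fyy z = 2 * b * (p * z) + 2 * b * z ^ n"
      by (simp add: fxx_def fyy_def p_def field_simps)
    have "of_real (Re z) * fx z + of_real (Im z) * fy z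
       = ((p * z) * R z + b * z ^ n * (2 * (z * w))) / 2"
      by (simp only: X Y fx_def fy_def p_def[symmetric] w_def[symmetric]) (simp add: field_simps)
    then have "of_real ((1 - (cmod z)\<^sup>2) / 4) * (fxx z + fyy z)
       + of_real (Re z) * fx z + of_real (Im z) * fy z
       = (1 - z * w) / 4 * (2 * b * (N * z ^ n) + 2 * b * z ^ n)
         + ((N * z ^ n) * R z + b * z ^ n * (2 * (z * w))) / 2"
      unfolding m L p by (simp add: add.assoc)
    also have "\<dots> = z ^ n * R z / 2"
      by (simp add: R_def w_def[symmetric] a_def b_def N_def field_simps)
    finally show ?thesis by (simp add: f)
  qed
  show ?thesis
    by (rule T2_solutionI[OF cont, of fx fy fxx fyy]) (use 1 2 3 4 5 in \<open>simp add: T2_equation_at_def\<close>)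
qed

definition circular_solution :: "int \<Rightarrow> complex \<Rightarrow> complex" where
  "circular_solution m z =
     (if m \<ge> 0 then power_solution (nat m) z else cnj (power_solution (nat (- m)) z))"

lemma T2_solution_circular: "T2_solution (circular_solution m)"
  using T2_solution_power T2_solution_cnj[OF T2_solution_power[of "nat (- m)"]]
  unfolding circular_solution_def by (cases "m \<ge> 0") auto

lemma power_solution_polar:
  "power_solution n (of_real r * cis t) = of_real (radial_factor n r) * cis (real n * t)"
proof -
  have "of_real r * cis t * cnj (of_real r * cis t) = complex_of_real (r\<^sup>2)"
    by (simp only: complex_norm_square[symmetric] norm_mult) simp
  then show ?thesis
    unfolding power_solution_def radial_factor_def
    by (simp add: power_mult_distrib Complex.DeMoivre mult_ac)
qed

lemma circular_solution_polar:
  "circular_solution m (of_real r * cis t)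
     = of_real (radial_factor (nat \<bar>m\<bar>) r) * cis (of_int m * t)"
  by (auto simp: circular_solution_def power_solution_polar cis_cnj)

section \<open>Trigonometric polynomials\<close>

definition trig_poly :: "(real \<Rightarrow> complex) \<Rightarrow> bool" where
  "trig_poly f \<longleftrightarrow> (\<exists>A a. finite A \<and> (\<forall>t. f t = (\<Sum>m\<in>A. a m * cis (of_int m * t))))"

lemma trig_poly_monomial: "trig_poly (\<lambda>t. c * cis (of_int m * t))"
  unfolding trig_poly_def by (intro exI[of _ "{m}"] exI[of _ "\<lambda>_. c"]) auto

lemma trig_poly_const: "trig_poly (\<lambda>t. c)"
  using trig_poly_monomial[of c 0] by simp

lemma trig_poly_add:
  assumes "trig_poly f" "trig_poly g"
  shows "trig_poly (\<lambda>t. f t + g t)"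
proof -
  obtain A a B b where A: "finite A" "\<And>t. f t = (\<Sum>m\<in>A. a m * cis (of_int m * t))"
    and B: "finite B" "\<And>t. g t = (\<Sum>m\<in>B. b m * cis (of_int m * t))"
    using assms unfolding trig_poly_def by blast
  define c where "c = (\<lambda>m. (if m \<in> A then a m else 0) + (if m \<in> B then b m else 0))"
  have "f t + g t = (\<Sum>m\<in>A \<union> B. c m * cis (of_int m * t))" for t
  proof -
    have "f t = (\<Sum>m\<in>A \<union> B. (if m \<in> A then a m else 0) * cis (of_int m * t))"
      unfolding A(2) using A(1) B(1) by (intro sum.mono_neutral_cong_left) auto
    moreover have "g t = (\<Sum>m\<in>A \<union> B. (if m \<in> B then b m else 0) * cis (of_int m * t))"
      unfolding B(2) using A(1) B(1) by (intro sum.mono_neutral_cong_left) auto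
    ultimately show ?thesis by (simp add: c_def sum.distrib distrib_right)
  qed
  then show ?thesis
    unfolding trig_poly_def using A(1) B(1) by (intro exI[of _ "A \<union> B"] exI[of _ c]) auto
qed

lemma trig_poly_mult_monomial:
  assumes "trig_poly f"
  shows "trig_poly (\<lambda>t. c * cis (of_int k * t) * f t)"
proof -
  obtain A a where A: "finite A" "\<And>t. f t = (\<Sum>m\<in>A. a m * cis (of_int m * t))"
    using assms unfolding trig_poly_def by blast
  have "c * cis (of_int k * t) * f t
      = (\<Sum>m\<in>(\<lambda>m. m + k) ` A. c * a (m - k) * cis (of_int m * t))" for t
  proof -
    have "c * cis (of_int k * t) * f t = (\<Sum>m\<in>A. c * a m * (cis (of_int k * t) * cis (of_int m * t)))"
      unfolding A(2) sum_distrib_left by (simp add: mult_ac)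
    also have "\<dots> = (\<Sum>m\<in>A. c * a m * cis (of_int (m + k) * t))"
      by (simp add: cis_mult distrib_right add.commute)
    also have "\<dots> = (\<Sum>m\<in>(\<lambda>m. m + k) ` A. c * a (m - k) * cis (of_int m * t))"
      by (subst sum.reindex) (simp_all add: inj_on_def)
    finally show ?thesis .
  qed
  then show ?thesis
    unfolding trig_poly_def using A(1)
    by (intro exI[of _ "(\<lambda>m. m + k) ` A"] exI[of _ "\<lambda>m. c * a (m - k)"]) auto
qed

lemma trig_poly_mult:
  assumes "trig_poly f" "trig_poly g"
  shows "trig_poly (\<lambda>t. f t * g t)"
proof -
  obtain A a where A: "finite A" "\<And>t. f t = (\<Sum>m\<in>A. a m * cis (of_int m * t))"
    using assms(1) unfolding trig_poly_def by blast
  have "trig_poly (\<lambda>t. (\<Sum>m\<in>A. a m * cis (of_int m * t)) * g t)"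
    using A(1)
  proof (induction A)
    case (insert m A)
    then show ?case
      using trig_poly_add[OF trig_poly_mult_monomial[OF assms(2), of "a m" m] insert.IH]
      by (simp only: sum.insert[OF insert.hyps] distrib_right)
  qed (simp add: trig_poly_const)
  then show ?thesis by (simp add: A(2))
qed

text \<open>On the unit circle the coordinates are trigonometric polynomials of degree 1, and products of
  trigonometric polynomials are again such. This turns the Stone-Weierstrass theorem for polynomials
  in \<open>x\<close> and \<open>y\<close> into trigonometric approximation.\<close>

lemma trig_poly_of_real_polynomial:
  assumes "real_polynomial_function p"
  shows "trig_poly (\<lambda>t. of_real (p (cis t)))"
  using assms
proof (induction rule: real_polynomial_function.induct)
  case (linear p)
  have p: "p (cis t) = cos t * p 1 + sin t * p \<i>" for t
  proof -
    have "cis t = cos t *\<^sub>R 1 + sin t *\<^sub>R \<i>" by (simp add: complex_eq_iff)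
    then show ?thesis
      using bounded_linear.linear[OF linear]
      by (simp only: linear_add linear_scale real_scaleR_def)
  qed
  have eq: "of_real (p (cis t)) = (of_real (p 1) - \<i> * of_real (p \<i>)) / 2 * cis (of_int 1 * t)
      + (of_real (p 1) + \<i> * of_real (p \<i>)) / 2 * cis (of_int (- 1) * t)" for t
    unfolding p by (simp add: complex_eq_iff field_simps)
  then show ?case
    unfolding eq by (intro trig_poly_add trig_poly_monomial)
qed (auto intro: trig_poly_const trig_poly_add trig_poly_mult)

lemma trig_poly_approximation:
  assumes "continuous_on (sphere 0 1) g" "\<epsilon> > 0"
  obtains f where "trig_poly f" "\<And>t. cmod (g (cis t) - f t) < \<epsilon>"
proof -
  obtain p where p: "polynomial_function p" "\<And>z. z \<in> sphere 0 1 \<Longrightarrow> cmod (g z - p z) < \<epsilon>"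
    using Stone_Weierstrass_polynomial_function[OF compact_sphere assms] by blast
  have "real_polynomial_function (Re \<circ> p)" "real_polynomial_function (Im \<circ> p)"
    using p(1) bounded_linear_Re bounded_linear_Im unfolding polynomial_function_def by blast+
  from this[THEN trig_poly_of_real_polynomial]
  have "trig_poly (\<lambda>t. of_real (Re (p (cis t))) + \<i> * of_real (Im (p (cis t))))"
    by (intro trig_poly_add trig_poly_mult trig_poly_const) (simp_all add: o_def)
  then have "trig_poly (\<lambda>t. p (cis t))"
    by (simp add: complex_eq[symmetric])
  then show ?thesis using p(2) by (intro that) auto
qed

section \<open>Kernels with prescribed Fourier coefficients\<close>

text \<open>The period \<open>[-\<pi>/2, 3\<pi>/2]\<close> is used because the sign changes of \<open>cos\<close> cut it into just two
  intervals, which matters for the integral of a modulus at the end.\<close>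

lemma cis_period_integral:
  "((\<lambda>\<theta>. cis (of_int k * \<theta>)) has_integral (if k = 0 then 2 * pi else 0)) {- (pi / 2)..3 * pi / 2}"
proof (cases "k = 0")
  case True
  then show ?thesis
    using has_integral_const_real[of "1 :: complex" "- (pi / 2)" "3 * pi / 2"]
    by (simp add: scaleR_conv_of_real)
next
  case False
  define F where "F = (\<lambda>\<theta>. cis (of_int k * \<theta>) / (\<i> * of_int k))"
  have "(F has_vector_derivative cis (of_int k * \<theta>)) (at \<theta> within S)" for \<theta> S
  proof -
    have "((\<lambda>\<theta>. cis (of_int k * \<theta>)) has_vector_derivative (of_int k * (\<i> * cis (of_int k * \<theta>)))) (at \<theta> within S)"
      unfolding has_vector_derivative_def
      by (rule derivative_eq_intros refl)+ (auto simp: scaleR_conv_of_real algebra_simps)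
    then have "(F has_vector_derivative (of_int k * (\<i> * cis (of_int k * \<theta>))) / (\<i> * of_int k)) (at \<theta> within S)"
      unfolding F_def by (rule has_vector_derivative_divide)
    then show ?thesis using False by (simp add: field_simps)
  qed
  then have "((\<lambda>\<theta>. cis (of_int k * \<theta>)) has_integral (F (3 * pi / 2) - F (- (pi / 2)))) {- (pi / 2)..3 * pi / 2}"
    by (intro fundamental_theorem_of_calculus) auto
  moreover have "cis (of_int k * (3 * pi / 2)) = cis (of_int k * (- (pi / 2)))"
  proof -
    have "of_int k * (3 * pi / 2) = of_int k * (- (pi / 2)) + 2 * pi * of_int k"
      by (simp add: field_simps)
    then have "cis (of_int k * (3 * pi / 2)) = cis (of_int k * (- (pi / 2))) * cis (2 * pi * of_int k)"
      by (simp only: cis_mult)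
    then show ?thesis by (simp add: cis_multiple_2pi)
  qed
  ultimately show ?thesis using False by (simp add: F_def)
qed

lemma cos_cis_period_integral:
  "((\<lambda>\<theta>. of_real (cos (real n * \<theta>)) * cis (of_int m * \<theta>)) has_integral
     ((if m = - int n then pi else 0) + (if m = int n then pi else 0))) {- (pi / 2)..3 * pi / 2}"
proof -
  have "of_real (cos (real n * \<theta>)) * cis (of_int m * \<theta>)
     = (cis (of_int (m + int n) * \<theta>) + cis (of_int (m - int n) * \<theta>)) / 2" for \<theta>
  proof -
    have "complex_of_real (cos (real n * \<theta>)) = (cis (real n * \<theta>) + cis (- (real n * \<theta>))) / 2"
      by (simp add: complex_eq_iff)
    then show ?thesis by (simp add: cis_mult algebra_simps add_divide_distrib)
  qed
  note product = this
  have "((\<lambda>\<theta>. (cis (of_int (m + int n) * \<theta>) + cis (of_int (m - int n) * \<theta>)) / 2) has_integral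
     (complex_of_real (if m + int n = 0 then 2 * pi else 0)
        + complex_of_real (if m - int n = 0 then 2 * pi else 0)) / 2) {- (pi / 2)..3 * pi / 2}"
    by (intro has_integral_divide has_integral_add cis_period_integral)
  moreover have "(complex_of_real (if m + int n = 0 then 2 * pi else 0)
        + complex_of_real (if m - int n = 0 then 2 * pi else 0)) / 2
      = of_real ((if m = - int n then pi else 0) + (if m = int n then pi else 0))"
    by auto
  ultimately show ?thesis by (simp only: product)
qed

text \<open>The even function \<open>q\<^sub>0 + 2 \<Sum>\<^bsub>n\<ge>1\<^esub> q\<^sub>n cos n\<theta>\<close>, that is \<open>\<Sum>\<^bsub>m\<^esub> q\<^bsub>|m|\<^esub> e\<^bsup>im\<theta>\<^esup>\<close> over all integers
  \<open>m\<close>.\<close>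

definition cosine_kernel :: "(nat \<Rightarrow> real) \<Rightarrow> real \<Rightarrow> real" where
  "cosine_kernel q \<theta> = 2 * (\<Sum>n. q n * cos (real n * \<theta>)) - q 0"

lemma cosine_kernel_uniform_limit:
  assumes "summable (\<lambda>n. \<bar>q n\<bar>)"
  shows "uniform_limit UNIV (\<lambda>N \<theta>. 2 * (\<Sum>n<N. q n * cos (real n * \<theta>)) - q 0) (cosine_kernel q) sequentially"
proof -
  have *: "uniform_limit UNIV (\<lambda>N \<theta>. \<Sum>n<N. q n * cos (real n * \<theta>)) (\<lambda>\<theta>. \<Sum>n. q n * cos (real n * \<theta>)) sequentially"
    by (rule Weierstrass_m_test[OF _ assms]) (auto simp: abs_mult intro: mult_left_le)
  show ?thesis
  proof (rule uniform_limitI)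
    fix e :: real assume "e > 0"
    then have "\<forall>\<^sub>F N in sequentially. \<forall>\<theta>\<in>UNIV. dist (\<Sum>n<N. q n * cos (real n * \<theta>))
        (\<Sum>n. q n * cos (real n * \<theta>)) < e / 2"
      using uniform_limitD[OF *, of "e / 2"] by simp
    moreover have dd: "dist (2 * a - c) (2 * b - c) = 2 * dist a b" for a b c :: real
      by (simp add: dist_real_def abs_if)
    ultimately show "\<forall>\<^sub>F N in sequentially. \<forall>\<theta>\<in>UNIV. dist (2 * (\<Sum>n<N. q n * cos (real n * \<theta>)) - q 0)
        (cosine_kernel q \<theta>) < e"
      unfolding cosine_kernel_def dd by (simp add: less_divide_eq mult.commute)
  qed
qed

lemma continuous_on_cosine_kernel:
  assumes "summable (\<lambda>n. \<bar>q n\<bar>)"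
  shows "continuous_on A (cosine_kernel q)"
proof -
  have "continuous_on UNIV (cosine_kernel q)"
    by (rule uniform_limit_theorem[OF _ cosine_kernel_uniform_limit[OF assms]])
      (auto intro!: always_eventually continuous_intros)
  then show ?thesis using continuous_on_subset by blast
qed

text \<open>Absolute summability of the coefficients makes the Fourier series converge uniformly, so it may
  be integrated term by term.\<close>

lemma cosine_kernel_moment:
  assumes q: "summable (\<lambda>n. \<bar>q n\<bar>)"
  shows "((\<lambda>\<theta>. of_real (cosine_kernel q \<theta>) * cis (of_int m * \<theta>)) has_integral
     of_real (2 * pi * q (nat \<bar>m\<bar>))) {- (pi / 2)..3 * pi / 2}"
proof -
  define I where "I = {- (pi / 2)..3 * pi / 2}"
  define S where "S = (\<lambda>N \<theta>. 2 * (\<Sum>n<N. q n * cos (real n * \<theta>)) - q 0)"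
  define f where "f = (\<lambda>N \<theta>. of_real (S N \<theta>) * cis (of_int m * \<theta>))"
  have S: "uniform_limit UNIV S (cosine_kernel q) sequentially"
    unfolding S_def by (rule cosine_kernel_uniform_limit[OF q])
  have lim: "uniform_limit I f (\<lambda>\<theta>. of_real (cosine_kernel q \<theta>) * cis (of_int m * \<theta>)) sequentially"
    unfolding f_def uniform_limit_iff
  proof (intro allI impI)
    fix e :: real assume "e > 0"
    then have "\<forall>\<^sub>F N in sequentially. \<forall>\<theta>\<in>UNIV. dist (S N \<theta>) (cosine_kernel q \<theta>) < e"
      using S unfolding uniform_limit_iff by blast
    then show "\<forall>\<^sub>F N in sequentially. \<forall>\<theta>\<in>I. dist (of_real (S N \<theta>) * cis (of_int m * \<theta>))
        (of_real (cosine_kernel q \<theta>) * cis (of_int m * \<theta>)) < e"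
    proof eventually_elim
      case (elim N)
      have "dist (of_real (S N \<theta>) * cis (of_int m * \<theta>)) (of_real (cosine_kernel q \<theta>) * cis (of_int m * \<theta>))
          = dist (S N \<theta>) (cosine_kernel q \<theta>)" for \<theta>
      proof -
        have "of_real (S N \<theta>) * cis (of_int m * \<theta>) - of_real (cosine_kernel q \<theta>) * cis (of_int m * \<theta>)
            = of_real (S N \<theta> - cosine_kernel q \<theta>) * cis (of_int m * \<theta>)"
          by (simp add: left_diff_distrib)
        then show ?thesis by (simp only: dist_norm norm_mult norm_of_real) simp
      qed
      with elim show ?case by simp
    qed
  qed
  have cont: "continuous_on I (f N)" for N
    unfolding f_def S_def by (intro continuous_intros)
  obtain J K where J: "\<And>N. (f N has_integral J N) I"
    and K: "((\<lambda>\<theta>. of_real (cosine_kernel q \<theta>) * cis (of_int m * \<theta>)) has_integral K) I"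
    and JK: "J \<longlonglongrightarrow> K"
    using uniform_limit_integral[OF lim[unfolded I_def] cont[unfolded I_def] trivial_limit_sequentially]
    unfolding I_def by blast
  have "J N = of_real (2 * pi * q (nat \<bar>m\<bar>))" if N: "N > nat \<bar>m\<bar>" for N
  proof -
    have "f N = (\<lambda>\<theta>. (\<Sum>n<N. of_real (2 * q n) * (of_real (cos (real n * \<theta>)) * cis (of_int m * \<theta>)))
       - of_real (q 0) * cis (of_int m * \<theta>))"
      unfolding f_def S_def fun_eq_iff of_real_diff of_real_mult of_real_sum left_diff_distrib
        sum_distrib_left sum_distrib_right mult.assoc by simp
    moreover have "(\<dots> has_integral ((\<Sum>n<N. of_real (2 * q n) *
         complex_of_real ((if m = - int n then pi else 0) + (if m = int n then pi else 0)))
       - of_real (q 0) * complex_of_real (if m = 0 then 2 * pi else 0))) I"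
      unfolding I_def
      by (intro has_integral_diff has_integral_sum has_integral_mult_right
          cos_cis_period_integral cis_period_integral) auto
    ultimately have "J N = (\<Sum>n<N. of_real (2 * q n) *
         complex_of_real ((if m = - int n then pi else 0) + (if m = int n then pi else 0)))
       - of_real (q 0) * complex_of_real (if m = 0 then 2 * pi else 0)"
      by (intro has_integral_unique[OF J]) simp
    also have "\<dots> = of_real ((\<Sum>n<N. 2 * q n * ((if m = - int n then pi else 0) + (if m = int n then pi else 0)))
       - q 0 * (if m = 0 then 2 * pi else 0))"
      by simp
    also have "(\<Sum>n<N. 2 * q n * ((if m = - int n then pi else 0) + (if m = int n then pi else 0)))
       = (\<Sum>n<N. if n = nat \<bar>m\<bar> then 2 * q n * (if m = 0 then 2 * pi else pi) else 0)"
    proof (rule sum.cong)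
      fix n
      have "(if m = - int n then pi else 0) + (if m = int n then pi else 0)
         = (if n = nat \<bar>m\<bar> then (if m = 0 then 2 * pi else pi) else 0)" by auto
      then show "2 * q n * ((if m = - int n then pi else 0) + (if m = int n then pi else 0))
         = (if n = nat \<bar>m\<bar> then 2 * q n * (if m = 0 then 2 * pi else pi) else 0)" by simp
    qed simp
    also have "\<dots> = 2 * q (nat \<bar>m\<bar>) * (if m = 0 then 2 * pi else pi)"
      using N by (subst sum.delta) auto
    finally show ?thesis by (cases "m = 0") simp_all
  qed
  then have "J \<longlonglongrightarrow> of_real (2 * pi * q (nat \<bar>m\<bar>))"
    by (intro tendsto_eventually eventually_sequentiallyI[of "Suc (nat \<bar>m\<bar>)"]) auto
  then have "K = of_real (2 * pi * q (nat \<bar>m\<bar>))" using JK LIMSEQ_unique by blast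
  with K show ?thesis by (simp add: I_def)
qed

section \<open>A Poisson formula on smaller circles\<close>

text \<open>The two bounds make \<open>\<phi>\<^sub>n(r) / \<phi>\<^sub>n(\<rho>)\<close> comparable to a geometric sequence of ratio \<open>r / \<rho>\<close>, up
  to a factor linear in \<open>n\<close>.\<close>

lemma radial_factor_bounds:
  assumes "0 \<le> r" "r \<le> 1"
  shows "r ^ n / 2 \<le> radial_factor n r" "radial_factor n r \<le> real (Suc n) * r ^ n"
proof -
  have r2: "0 \<le> r\<^sup>2" "r\<^sup>2 \<le> 1" using assms by (auto simp: power_le_one)
  have lo: "1 \<le> (real n + 1) - (real n - 1) * r\<^sup>2"
  proof (cases n)
    case (Suc k)
    have "real k * r\<^sup>2 \<le> real k * 1" using r2 by (intro mult_left_mono) auto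
    then show ?thesis using Suc by simp
  qed (use r2 in simp)
  have hi: "(real n + 1) - (real n - 1) * r\<^sup>2 \<le> 2 * real (Suc n)"
  proof (cases n)
    case (Suc k)
    have "0 \<le> real k * r\<^sup>2" using r2 by simp
    then have "- (real k * r\<^sup>2) \<le> real k + 2" using of_nat_0_le_iff[of k] by linarith
    then show ?thesis using Suc by simp
  qed (use r2 in simp)
  have rn: "0 \<le> r ^ n" using assms by simp
  show "r ^ n / 2 \<le> radial_factor n r"
    using mult_left_mono[OF lo rn] by (simp add: radial_factor_def)
  show "radial_factor n r \<le> real (Suc n) * r ^ n"
    using mult_left_mono[OF hi rn] by (simp add: radial_factor_def field_simps)
qed

lemma radial_factor_pos: "0 < r \<Longrightarrow> r \<le> 1 \<Longrightarrow> 0 < radial_factor n r"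
  using radial_factor_bounds(1)[of r n] zero_less_power[of r n] by linarith

text \<open>The bound depends on \<open>\<rho>\<close> only through \<open>\<sigma> \<le> \<rho>\<close>, so it serves as a common majorant for all \<open>\<rho>\<close>
  near 1.\<close>

lemma radial_factor_quotient_bound:
  assumes "0 \<le> r" "r < \<sigma>" "\<sigma> \<le> \<rho>" "\<rho> \<le> 1"
  shows "\<bar>radial_factor n r / radial_factor n \<rho>\<bar> \<le> 2 * (real (Suc n) * (r / \<sigma>) ^ n)"
proof -
  have r0: "0 \<le> radial_factor n r"
    using radial_factor_bounds(1)[of r n] zero_le_power[of r n] assms by linarith
  have "radial_factor n \<rho> \<ge> \<sigma> ^ n / 2"
  proof -
    have "\<sigma> ^ n \<le> \<rho> ^ n" using assms by (intro power_mono) auto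
    then show ?thesis using radial_factor_bounds(1)[of \<rho> n] assms by linarith
  qed
  then have "radial_factor n r / radial_factor n \<rho> \<le> (real (Suc n) * r ^ n) / (\<sigma> ^ n / 2)"
    using radial_factor_bounds(2)[of r n] r0 assms by (intro frac_le) auto
  moreover have "0 \<le> radial_factor n r / radial_factor n \<rho>"
    using r0 radial_factor_pos[of \<rho> n] assms by auto
  ultimately show ?thesis by (simp add: power_divide mult_ac)
qed

lemma summable_radial_factor_majorant:
  assumes "0 \<le> r" "r < \<sigma>"
  shows "summable (\<lambda>n. 2 * (real (Suc n) * (r / \<sigma>) ^ n))"
proof -
  have "norm (r / \<sigma>) < 1" using assms by simp
  then show ?thesis by (intro summable_mult sums_summable[OF geometric_deriv_sums])
qed

lemma summable_radial_factor_quotient: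
  assumes "0 \<le> r" "r < \<rho>" "\<rho> \<le> 1"
  shows "summable (\<lambda>n. \<bar>radial_factor n r / radial_factor n \<rho>\<bar>)"
  by (rule summable_comparison_test'[OF summable_radial_factor_majorant[OF assms(1,2)], of 0])
    (use radial_factor_quotient_bound[OF assms(1,2) order_refl assms(3)] in simp)

text \<open>A Poisson formula on the circle of radius \<open>\<rho>\<close>. For a circular solution it is the statement that
  the kernel has Fourier coefficients \<open>\<phi>\<^sub>n(r) / \<phi>\<^sub>n(\<rho>)\<close>; both sides of the formula depend continuously on \<open>u\<close>
  in the supremum norm on the closed disk of radius \<open>\<rho>\<close>, where combinations of circular solutions
  are dense in all solutions. The angle \<open>t\<close> sits in the argument of \<open>u\<close> rather than in the kernel,
  which keeps the kernel independent of the direction of the point.\<close>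

lemma T2_solution_reproducing:
  assumes u: "T2_solution u" and r: "0 \<le> r" "r < \<rho>" and \<rho>: "\<rho> < 1"
  defines "K \<equiv> cosine_kernel (\<lambda>n. radial_factor n r / radial_factor n \<rho>)"
  shows "((\<lambda>\<theta>. of_real (K \<theta>) * u (of_real \<rho> * cis (\<theta> + t))) has_integral
     of_real (2 * pi) * u (of_real r * cis t)) {- (pi / 2)..3 * pi / 2}"
proof -
  define I where "I = {- (pi / 2)..3 * pi / 2}"
  define q where "q = (\<lambda>n. radial_factor n r / radial_factor n \<rho>)"
  have q: "summable (\<lambda>n. \<bar>q n\<bar>)"
    unfolding q_def using r \<rho> by (intro summable_radial_factor_quotient) auto
  have pos: "radial_factor n \<rho> > 0" for n using r \<rho> by (intro radial_factor_pos) auto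
  have contK: "continuous_on I K" unfolding K_def using q unfolding q_def by (rule continuous_on_cosine_kernel)
  have contu: "continuous_on unit_disk u" using T2_solutionE[OF u] by blast
  have in_disk: "of_real \<rho> * cis x \<in> unit_disk" for x using r \<rho> by (simp add: norm_mult)
  have intble: "(\<lambda>\<theta>. of_real (K \<theta>) * f (of_real \<rho> * cis (\<theta> + t))) integrable_on I"
    if "continuous_on unit_disk f" for f :: "complex \<Rightarrow> complex"
    unfolding I_def
  proof (rule integrable_continuous_interval)
    have "continuous_on {- (pi / 2)..3 * pi / 2} (\<lambda>\<theta>. f (of_real \<rho> * cis (\<theta> + t)))"
      using in_disk by (intro continuous_on_compose2[OF that] continuous_intros) auto
    then show "continuous_on {- (pi / 2)..3 * pi / 2} (\<lambda>\<theta>. of_real (K \<theta>) * f (of_real \<rho> * cis (\<theta> + t)))"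
      using contK unfolding I_def by (intro continuous_intros)
  qed
  have intK: "(\<lambda>\<theta>. \<bar>K \<theta>\<bar>) integrable_on I"
    using contK unfolding I_def by (intro integrable_continuous_interval continuous_intros)
  define J where "J = integral I (\<lambda>\<theta>. of_real (K \<theta>) * u (of_real \<rho> * cis (\<theta> + t)))"
  define M where "M = integral I (\<lambda>\<theta>. \<bar>K \<theta>\<bar>)"
  have M: "M \<ge> 0" unfolding M_def by (intro integral_nonneg intK) auto
  have bound: "cmod (J - of_real (2 * pi) * u (of_real r * cis t)) \<le> \<epsilon> * (M + 2 * pi)" if \<epsilon>: "\<epsilon> > 0" for \<epsilon>
  proof -
    have "continuous_on (sphere 0 1) (\<lambda>w. u (of_real \<rho> * w))"
      using r \<rho> by (intro continuous_on_compose2[OF contu] continuous_intros) (auto simp: norm_mult)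
    then obtain f where "trig_poly f" and approx: "\<And>x. cmod (u (of_real \<rho> * cis x) - f x) < \<epsilon>"
      using trig_poly_approximation[OF _ \<epsilon>] by metis
    then obtain A a where A: "finite A" and f: "\<And>x. f x = (\<Sum>m\<in>A. a m * cis (of_int m * x))"
      unfolding trig_poly_def by blast
    \<comment> \<open>The combination of circular solutions with boundary values \<open>f\<close> on the circle of radius \<open>\<rho>\<close>.\<close>
    define b where "b = (\<lambda>m. a m / of_real (radial_factor (nat \<bar>m\<bar>) \<rho>))"
    define U where "U = (\<lambda>z. \<Sum>m\<in>A. b m * circular_solution m z)"
    have U: "T2_solution U"
      unfolding U_def using A by (intro T2_solution_sum T2_solution_circular)
    have contU: "continuous_on unit_disk U" using T2_solutionE[OF U] by blast
    have bm: "b m * of_real (radial_factor (nat \<bar>m\<bar>) \<rho>) = a m" for m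
      using pos[of "nat \<bar>m\<bar>"] by (simp add: b_def)
    have Uf: "U (of_real \<rho> * cis x) = f x" for x
      unfolding U_def f circular_solution_polar by (simp add: bm mult.assoc[symmetric])
    have close_bdry: "cmod (u (of_real \<rho> * cis x) - U (of_real \<rho> * cis x)) \<le> \<epsilon>" for x
      unfolding Uf using approx[of x] by simp
    have "cmod (u (of_real r * cis t) - U (of_real r * cis t)) \<le> \<epsilon>"
    proof -
      have "T2_solution (\<lambda>z. 1 * u z + (- 1) * U z)" by (rule T2_solution_lincomb[OF u U])
      then have "T2_solution (\<lambda>z. u z - U z)" by simp
      then show ?thesis
      proof (rule T2_maximum_principle[of _ \<rho>])
        fix z assume "cmod z = \<rho>"
        then have "z = of_real \<rho> * cis (Arg z)"
          using rcis_cmod_Arg[of z] by (simp add: rcis_def)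
        then show "cmod (u z - U z) \<le> \<epsilon>" using close_bdry[of "Arg z"] by metis
      qed (use r \<rho> in \<open>auto simp: norm_mult\<close>)
    qed
    note close = this
    have "((\<lambda>\<theta>. of_real (K \<theta>) * U (of_real \<rho> * cis (\<theta> + t))) has_integral
       of_real (2 * pi) * U (of_real r * cis t)) I"
    proof -
      have "((\<lambda>\<theta>. \<Sum>m\<in>A. (a m * cis (of_int m * t)) * (of_real (K \<theta>) * cis (of_int m * \<theta>))) has_integral
         (\<Sum>m\<in>A. (a m * cis (of_int m * t)) * of_real (2 * pi * q (nat \<bar>m\<bar>)))) I"
        unfolding I_def K_def q_def[symmetric]
        by (intro has_integral_sum has_integral_mult_right cosine_kernel_moment q A)
      moreover have "(\<Sum>m\<in>A. (a m * cis (of_int m * t)) * (of_real (K \<theta>) * cis (of_int m * \<theta>)))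
          = of_real (K \<theta>) * U (of_real \<rho> * cis (\<theta> + t))" for \<theta>
        unfolding Uf f sum_distrib_left
        by (intro sum.cong) (auto simp: distrib_left mult_ac simp flip: cis_mult)
      moreover have "(\<Sum>m\<in>A. (a m * cis (of_int m * t)) * of_real (2 * pi * q (nat \<bar>m\<bar>)))
          = of_real (2 * pi) * U (of_real r * cis t)"
        unfolding U_def circular_solution_polar sum_distrib_left b_def q_def
        by (intro sum.cong) (auto simp: mult_ac)
      ultimately show ?thesis by simp
    qed
    then have JU: "integral I (\<lambda>\<theta>. of_real (K \<theta>) * U (of_real \<rho> * cis (\<theta> + t)))
        = of_real (2 * pi) * U (of_real r * cis t)" by (rule integral_unique)
    have "J - integral I (\<lambda>\<theta>. of_real (K \<theta>) * U (of_real \<rho> * cis (\<theta> + t)))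
       = integral I (\<lambda>\<theta>. of_real (K \<theta>) * u (of_real \<rho> * cis (\<theta> + t)) - of_real (K \<theta>) * U (of_real \<rho> * cis (\<theta> + t)))"
      unfolding J_def by (rule integral_diff[symmetric, OF intble[OF contu] intble[OF contU]])
    moreover have "cmod \<dots> \<le> integral I (\<lambda>\<theta>. \<epsilon> * \<bar>K \<theta>\<bar>)"
    proof (rule integral_norm_bound_integral)
      fix \<theta>
      have "cmod (of_real (K \<theta>) * u (of_real \<rho> * cis (\<theta> + t)) - of_real (K \<theta>) * U (of_real \<rho> * cis (\<theta> + t)))
        = \<bar>K \<theta>\<bar> * cmod (u (of_real \<rho> * cis (\<theta> + t)) - U (of_real \<rho> * cis (\<theta> + t)))"
        by (simp add: norm_mult flip: right_diff_distrib)
      also have "\<dots> \<le> \<bar>K \<theta>\<bar> * \<epsilon>" by (intro mult_left_mono close_bdry) auto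
      finally show "cmod (of_real (K \<theta>) * u (of_real \<rho> * cis (\<theta> + t)) - of_real (K \<theta>) * U (of_real \<rho> * cis (\<theta> + t)))
          \<le> \<epsilon> * \<bar>K \<theta>\<bar>" by (simp add: mult.commute)
    next
      show "(\<lambda>\<theta>. \<epsilon> * \<bar>K \<theta>\<bar>) integrable_on I" using integrable_cmul[OF intK, of \<epsilon>] by simp
    qed (intro integrable_diff intble contu contU)
    moreover have "integral I (\<lambda>\<theta>. \<epsilon> * \<bar>K \<theta>\<bar>) = \<epsilon> * M" by (simp add: M_def)
    ultimately have "cmod (J - of_real (2 * pi) * U (of_real r * cis t)) \<le> \<epsilon> * M"
      unfolding JU by metis
    moreover have "cmod (of_real (2 * pi) * U (of_real r * cis t) - of_real (2 * pi) * u (of_real r * cis t)) \<le> \<epsilon> * (2 * pi)"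
    proof -
      have "cmod (of_real (2 * pi) * U (of_real r * cis t) - of_real (2 * pi) * u (of_real r * cis t))
         = 2 * pi * cmod (u (of_real r * cis t) - U (of_real r * cis t))"
        unfolding right_diff_distrib[symmetric] norm_mult norm_of_real by (simp add: norm_minus_commute)
      also have "\<dots> \<le> 2 * pi * \<epsilon>" using close by (intro mult_left_mono) auto
      finally show ?thesis by (simp add: mult.commute)
    qed
    ultimately show ?thesis
      using norm_triangle_le[of "J - of_real (2 * pi) * U (of_real r * cis t)"
          "of_real (2 * pi) * U (of_real r * cis t) - of_real (2 * pi) * u (of_real r * cis t)" "\<epsilon> * (M + 2 * pi)"]
      by (simp add: distrib_left)
  qed
  have "cmod (J - of_real (2 * pi) * u (of_real r * cis t)) \<le> 0"
  proof (rule field_le_epsilon)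
    fix e :: real assume e: "e > 0"
    have Mp: "M + 2 * pi > 0" using M pi_gt_zero by linarith
    show "cmod (J - of_real (2 * pi) * u (of_real r * cis t)) \<le> 0 + e"
      using bound[of "e / (M + 2 * pi)"] e Mp by simp
  qed
  then have "J = of_real (2 * pi) * u (of_real r * cis t)" by simp
  then show ?thesis
    using integrable_integral[OF intble[OF contu]] unfolding J_def I_def by metis
qed

section \<open>The limiting kernel\<close>

lemma one_minus_r_cos_pos:
  fixes r \<theta> :: real
  assumes "0 \<le> r" "r < 1"
  shows "1 - r * cos \<theta> > 0" "1 + r\<^sup>2 - 2 * r * cos \<theta> > 0"
proof -
  have "r * cos \<theta> \<le> r * 1" using assms by (intro mult_left_mono) auto
  then show "1 - r * cos \<theta> > 0" using assms by simp
  have eq: "1 + r\<^sup>2 - 2 * r * cos \<theta> = (1 - r)\<^sup>2 + 2 * (r - r * cos \<theta>)"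
    by (simp add: power2_eq_square algebra_simps)
  have "(1 - r)\<^sup>2 > 0" using assms by simp
  then show "1 + r\<^sup>2 - 2 * r * cos \<theta> > 0"
    unfolding eq using \<open>r * cos \<theta> \<le> r * 1\<close> by (intro add_pos_nonneg) simp_all
qed

lemma radial_factor_1: "radial_factor n 1 = 1"
  by (simp add: radial_factor_def)

text \<open>The Poisson kernel in closed form. Summing the geometric series and its derivative gives the
  real part of \<open>(1 - r\<^sup>2)/(1 - z)\<^sup>2 + 2 r\<^sup>2/(1 - z)\<close> minus \<open>(1 + r\<^sup>2)/2\<close> for \<open>z = r e\<^bsup>i\<theta>\<^esup>\<close>. With
  \<open>D = |1 - z|\<^sup>2\<close> and \<open>s = 1 - r\<^sup>2\<close>, the identity \<open>2 Re (1 - z) = D + s\<close> turns everything into a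
  rational function of \<open>D\<close>, which collapses to \<open>s\<^sup>3 / (2 D\<^sup>2)\<close>.\<close>

lemma cosine_kernel_radial_factor:
  assumes r: "0 \<le> r" "r < 1"
  shows "cosine_kernel (\<lambda>n. radial_factor n r) \<theta>
    = (1 - r\<^sup>2) ^ 3 / (2 * (1 + r\<^sup>2 - 2 * r * cos \<theta>)\<^sup>2)"
proof -
  define z where "z = of_real r * cis \<theta>"
  define D where "D = 1 + r\<^sup>2 - 2 * r * cos \<theta>"
  define s where "s = 1 - r\<^sup>2"
  define x where "x = 1 - r * cos \<theta>"
  have D: "D > 0" using one_minus_r_cos_pos[OF r] by (simp add: D_def)
  have nz: "cmod z < 1" using r by (simp add: z_def norm_mult)
  have s1: "(\<lambda>n. of_nat (Suc n) * z ^ n) sums (1 / (1 - z)\<^sup>2)"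
    by (rule geometric_deriv_sums[OF nz])
  have s2: "(\<lambda>n. z ^ n) sums (1 / (1 - z))"
    by (rule geometric_sums[OF nz])
  have "(\<lambda>n. (of_nat (Suc n) * z ^ n - of_real (r\<^sup>2) * (of_nat (Suc n) * z ^ n - 2 * z ^ n)) / 2) sums
     ((1 / (1 - z)\<^sup>2 - of_real (r\<^sup>2) * (1 / (1 - z)\<^sup>2 - 2 * (1 / (1 - z)))) / 2)"
    by (intro sums_divide sums_diff sums_mult s1 s2)
  from sums_Re[OF this]
  have sm: "(\<lambda>n. radial_factor n r * cos (real n * \<theta>)) sums
     Re ((1 / (1 - z)\<^sup>2 - of_real (r\<^sup>2) * (1 / (1 - z)\<^sup>2 - 2 * (1 / (1 - z)))) / 2)"
  proof (rule sums_cong[THEN iffD1, rotated])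
    fix n
    have zn: "z ^ n = of_real (r ^ n) * cis (real n * \<theta>)"
      by (simp add: z_def power_mult_distrib Complex.DeMoivre)
    have "(of_nat (Suc n) * z ^ n - of_real (r\<^sup>2) * (of_nat (Suc n) * z ^ n - 2 * z ^ n)) / 2
       = of_real ((real (Suc n) - r\<^sup>2 * (real (Suc n) - 2)) / 2) * z ^ n"
      by (simp add: algebra_simps add_divide_distrib diff_divide_distrib)
    also have "\<dots> = of_real (radial_factor n r) * cis (real n * \<theta>)"
      by (simp add: zn radial_factor_def algebra_simps)
    finally show "Re ((of_nat (Suc n) * z ^ n - of_real (r\<^sup>2) * (of_nat (Suc n) * z ^ n - 2 * z ^ n)) / 2)
       = radial_factor n r * cos (real n * \<theta>)" by simp
  qed
  have Dz: "(cmod (1 - z))\<^sup>2 = D"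
    unfolding cmod_power2 z_def D_def
    by (simp add: power2_eq_square algebra_simps flip: distrib_left)
  have i1: "1 / (1 - z) = cnj (1 - z) / of_real D"
    using complex_norm_square[of "1 - z"] D nz Dz by (auto simp: field_simps)
  have x: "2 * x = D + s" by (simp add: x_def D_def s_def)
  have R1: "Re (1 / (1 - z)) = x / D"
    unfolding i1 by (simp add: x_def z_def)
  have I1: "(Im (1 / (1 - z)))\<^sup>2 = 1 / D - (x / D)\<^sup>2"
  proof -
    have "(cmod (1 / (1 - z)))\<^sup>2 = 1 / D" by (simp add: norm_divide power_divide Dz)
    then show ?thesis unfolding cmod_power2 R1 by simp
  qed
  have "1 / (1 - z)\<^sup>2 = (1 / (1 - z))\<^sup>2" by (simp add: power_divide)
  then have R2: "Re (1 / (1 - z)\<^sup>2) = 2 * (x / D)\<^sup>2 - 1 / D"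
    by (simp only: Re_power2 I1 R1)
  have "cosine_kernel (\<lambda>n. radial_factor n r) \<theta>
      = (Re (1 / (1 - z)\<^sup>2) - r\<^sup>2 * (Re (1 / (1 - z)\<^sup>2) - 2 * Re (1 / (1 - z)))) - (1 + r\<^sup>2) / 2"
  proof -
    define w1 w2 where "w1 = 1 / (1 - z)" and "w2 = 1 / (1 - z)\<^sup>2"
    have "(\<Sum>n. radial_factor n r * cos (real n * \<theta>)) = Re ((w2 - of_real (r\<^sup>2) * (w2 - 2 * w1)) / 2)"
      using sums_unique[OF sm] by (simp only: w1_def w2_def)
    also have "\<dots> = (Re w2 - r\<^sup>2 * (Re w2 - 2 * Re w1)) / 2"
      by (simp del: of_real_power)
    finally show ?thesis
      unfolding cosine_kernel_def w1_def[symmetric] w2_def[symmetric] by (simp add: radial_factor_def)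
  qed
  also have "\<dots> = s * (2 * (x / D)\<^sup>2 - 1 / D) + 2 * (1 - s) * (x / D) - (2 - s) / 2"
    unfolding R1 R2 by (simp add: s_def algebra_simps)
  also have "x = (D + s) / 2" using x by simp
  also have "s * (2 * ((D + s) / 2 / D)\<^sup>2 - 1 / D) + 2 * (1 - s) * ((D + s) / 2 / D) - (2 - s) / 2
      = s ^ 3 / (2 * D\<^sup>2)"
    using D by (simp add: field_simps power2_eq_square power3_eq_cube)
  finally show ?thesis by (simp add: s_def D_def)
qed

text \<open>A primitive of the Poisson kernel. Integrating the representation of the kernel as the real part
  of a rational function of \<open>z = r e\<^bsup>i\<theta>\<^esup>\<close> gives this: the \<open>arctan\<close> is \<open>-arg (1 - z)\<close>, the last summand
  is \<open>(1 - r\<^sup>2) Im (1/(1 - z))\<close>, and both are smooth and periodic because \<open>Re (1 - z) > 0\<close>.\<close>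

definition kernel_primitive :: "real \<Rightarrow> real \<Rightarrow> real" where
  "kernel_primitive r \<theta> = (1 + r\<^sup>2) / 2 * \<theta> + (1 + r\<^sup>2) * arctan (r * sin \<theta> / (1 - r * cos \<theta>))
     + (1 - r\<^sup>2) * (r * sin \<theta>) / (1 + r\<^sup>2 - 2 * r * cos \<theta>)"

lemma kernel_primitive_deriv:
  assumes r: "0 \<le> r" "r < 1"
  shows "(kernel_primitive r has_real_derivative
     (1 - r\<^sup>2) ^ 3 / (2 * (1 + r\<^sup>2 - 2 * r * cos \<theta>)\<^sup>2)) (at \<theta> within A)"
proof -
  define C where "C = r * cos \<theta>"
  define S where "S = r * sin \<theta>"
  define D where "D = 1 + r\<^sup>2 - 2 * C"
  define s where "s = 1 - r\<^sup>2"
  have pos: "1 - C > 0" "D > 0" using one_minus_r_cos_pos[OF r, of \<theta>] by (auto simp: C_def D_def mult_ac)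
  have "S\<^sup>2 + C\<^sup>2 = r\<^sup>2"
    unfolding S_def C_def power_mult_distrib by (simp flip: distrib_left)
  then have S2: "S\<^sup>2 = r\<^sup>2 - C\<^sup>2" by simp
  have C: "C = (2 - s - D) / 2" and r2: "r\<^sup>2 = 1 - s" by (auto simp: D_def s_def)
  have MD: "(1 - C)\<^sup>2 + S\<^sup>2 = D" unfolding S2 D_def by (simp add: power2_eq_square algebra_simps)
  have "((\<lambda>\<theta>. arctan (r * sin \<theta> / (1 - r * cos \<theta>))) has_real_derivative
      inverse (1 + (S / (1 - C))\<^sup>2) * ((C * (1 - C) - S * S) / ((1 - C) * (1 - C)))) (at \<theta> within A)"
    by (rule derivative_eq_intros refl | use pos in \<open>simp add: C_def S_def\<close>)+
  also have "inverse (1 + (S / (1 - C))\<^sup>2) * ((C * (1 - C) - S * S) / ((1 - C) * (1 - C)))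
      = (C * (1 - C) - S\<^sup>2) / D"
  proof -
    have "1 + (S / (1 - C))\<^sup>2 = D / (1 - C)\<^sup>2" using pos by (simp add: field_simps flip: MD)
    then show ?thesis using pos by (simp add: power2_eq_square)
  qed
  also have "\<dots> = (s / D - 1) / 2"
    using pos unfolding S2 r2 C by (simp add: field_simps power2_eq_square)
  finally have 1: "((\<lambda>\<theta>. arctan (r * sin \<theta> / (1 - r * cos \<theta>))) has_real_derivative (s / D - 1) / 2) (at \<theta> within A)" .
  have 2: "((\<lambda>\<theta>. (1 - r\<^sup>2) * (r * sin \<theta>) / (1 + r\<^sup>2 - 2 * r * cos \<theta>)) has_real_derivative
      (s * C * D - s * S * (2 * S)) / (D * D)) (at \<theta> within A)"
    by (rule derivative_eq_intros refl | use pos in \<open>simp add: C_def S_def D_def s_def mult_ac\<close>)+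
  have "(kernel_primitive r has_real_derivative
     ((1 + r\<^sup>2) / 2 + (1 + r\<^sup>2) * ((s / D - 1) / 2) + (s * C * D - s * S * (2 * S)) / (D * D))) (at \<theta> within A)"
    unfolding kernel_primitive_def
    by (rule derivative_eq_intros 1 2 refl | simp)+
  also have "(s * C * D - s * S * (2 * S)) = s * (C * D - 2 * S\<^sup>2)"
    by (simp add: power2_eq_square algebra_simps)
  also have "(1 + r\<^sup>2) / 2 + (1 + r\<^sup>2) * ((s / D - 1) / 2) + s * (C * D - 2 * S\<^sup>2) / (D * D)
      = s ^ 3 / (2 * D\<^sup>2)"
    using pos unfolding S2 r2 C by (simp add: field_simps power2_eq_square power3_eq_cube)
  finally show ?thesis by (simp add: s_def D_def C_def mult_ac)
qed

text \<open>The constant subtracted is the value of the kernel at \<open>cos \<theta> = 0\<close>, so the difference has the sign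
  of \<open>cos \<theta>\<close>. The two intervals of constant sign have equal length, so this constant drops out and
  only values of the primitive remain.\<close>

lemma kernel_deviation_integral:
  assumes r: "0 \<le> r" "r < 1"
  shows "((\<lambda>\<theta>. \<bar>(1 - r\<^sup>2) ^ 3 / (2 * (1 + r\<^sup>2 - 2 * r * cos \<theta>)\<^sup>2) - (1 - r\<^sup>2) ^ 3 / (2 * (1 + r\<^sup>2)\<^sup>2)\<bar>)
     has_integral 4 * ((1 + r\<^sup>2) * arctan r + r * (1 - r\<^sup>2) / (1 + r\<^sup>2))) {- (pi / 2)..3 * pi / 2}"
proof -
  define P where "P = (\<lambda>\<theta>. (1 - r\<^sup>2) ^ 3 / (2 * (1 + r\<^sup>2 - 2 * r * cos \<theta>)\<^sup>2))"
  define k where "k = (1 - r\<^sup>2) ^ 3 / (2 * (1 + r\<^sup>2)\<^sup>2)"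
  define G where "G = (\<lambda>\<theta>. kernel_primitive r \<theta> - k * \<theta>)"
  have s: "(1 - r\<^sup>2) ^ 3 \<ge> 0" using r by (simp add: power_le_one)
  have GP: "(G has_vector_derivative (P \<theta> - k)) (at \<theta> within A)" for \<theta> A
    unfolding G_def P_def has_real_derivative_iff_has_vector_derivative[symmetric]
    by (rule derivative_eq_intros kernel_primitive_deriv[OF r] refl | simp)+
  have p0: "1 + r\<^sup>2 > 0" using zero_le_power2[of r] by linarith
  have D0: "1 + r\<^sup>2 - 2 * r * cos \<theta> > 0" for \<theta> using one_minus_r_cos_pos[OF r] by blast
  have "((\<lambda>\<theta>. P \<theta> - k) has_integral (G (pi / 2) - G (- (pi / 2)))) {- (pi / 2)..pi / 2}"
    by (intro fundamental_theorem_of_calculus GP) simp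
  moreover have "P \<theta> - k = \<bar>P \<theta> - k\<bar>" if "\<theta> \<in> {- (pi / 2)..pi / 2}" for \<theta>
  proof -
    have "cos \<theta> \<ge> 0" using that by (intro cos_ge_zero) auto
    then have "1 + r\<^sup>2 - 2 * r * cos \<theta> \<le> 1 + r\<^sup>2" using r by simp
    then have "k \<le> P \<theta>" unfolding P_def k_def using s D0[of \<theta>] p0
      by (intro divide_left_mono mult_left_mono power_mono mult_pos_pos zero_less_power) linarith+
    then show ?thesis by simp
  qed
  ultimately have 1: "((\<lambda>\<theta>. \<bar>P \<theta> - k\<bar>) has_integral (G (pi / 2) - G (- (pi / 2)))) {- (pi / 2)..pi / 2}"
    by (rule has_integral_eq[rotated])
  have "((\<lambda>\<theta>. - (P \<theta> - k)) has_integral - (G (3 * pi / 2) - G (pi / 2))) {pi / 2..3 * pi / 2}"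
    by (intro has_integral_neg fundamental_theorem_of_calculus GP) simp
  moreover have "- (P \<theta> - k) = \<bar>P \<theta> - k\<bar>" if "\<theta> \<in> {pi / 2..3 * pi / 2}" for \<theta>
  proof -
    have "cos (\<theta> - pi) \<ge> 0" using that by (intro cos_ge_zero) auto
    then have "r * cos \<theta> \<le> 0" using r by (simp add: mult_nonneg_nonpos)
    then have "1 + r\<^sup>2 \<le> 1 + r\<^sup>2 - 2 * r * cos \<theta>" by simp
    then have "P \<theta> \<le> k" unfolding P_def k_def using s D0[of \<theta>] p0
      by (intro divide_left_mono mult_left_mono power_mono mult_pos_pos zero_less_power) linarith+
    then show ?thesis by simp
  qed
  ultimately have 2: "((\<lambda>\<theta>. \<bar>P \<theta> - k\<bar>) has_integral - (G (3 * pi / 2) - G (pi / 2))) {pi / 2..3 * pi / 2}"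
    by (rule has_integral_eq[rotated])
  have "((\<lambda>\<theta>. \<bar>P \<theta> - k\<bar>) has_integral (G (pi / 2) - G (- (pi / 2)) + - (G (3 * pi / 2) - G (pi / 2))))
      {- (pi / 2)..3 * pi / 2}"
    by (rule has_integral_combine[OF _ _ 1 2]) auto
  moreover have "cos (3 * pi / 2) = 0" "sin (3 * pi / 2) = -1"
  proof -
    have e: "3 * pi / 2 = pi / 2 + pi" by simp
    show "cos (3 * pi / 2) = 0" "sin (3 * pi / 2) = -1" unfolding e by (simp_all only: cos_periodic_pi sin_periodic_pi) simp_all
  qed
  then have "G (pi / 2) - G (- (pi / 2)) + - (G (3 * pi / 2) - G (pi / 2))
      = 4 * ((1 + r\<^sup>2) * arctan r + r * (1 - r\<^sup>2) / (1 + r\<^sup>2))"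
  proof -
    assume c: "cos (3 * pi / 2) = 0" "sin (3 * pi / 2) = -1"
    define Q where "Q = r * (1 - r\<^sup>2) / (1 + r\<^sup>2)"
    have Q: "(1 - r\<^sup>2) * r / (1 + r\<^sup>2) = Q" "(1 - r\<^sup>2) * (- r) / (1 + r\<^sup>2) = - Q"
      by (simp_all add: Q_def mult.commute)
    have "G (pi / 2) = (1 + r\<^sup>2) / 2 * (pi / 2) + (1 + r\<^sup>2) * arctan r + Q - k * (pi / 2)"
      by (simp add: G_def kernel_primitive_def flip: Q)
    moreover have "G (- (pi / 2)) = (1 + r\<^sup>2) / 2 * (- (pi / 2)) - (1 + r\<^sup>2) * arctan r - Q - k * (- (pi / 2))"
      by (simp add: G_def kernel_primitive_def arctan_minus flip: Q)
    moreover have "G (3 * pi / 2) = (1 + r\<^sup>2) / 2 * (3 * pi / 2) - (1 + r\<^sup>2) * arctan r - Q - k * (3 * pi / 2)"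
      by (simp add: G_def kernel_primitive_def arctan_minus c flip: Q)
    ultimately show ?thesis unfolding Q_def[symmetric] by (simp only:) (simp add: field_simps)
  qed
  ultimately show ?thesis by (simp only: P_def k_def)
qed

section \<open>Passage to the unit circle\<close>

text \<open>Each term tends to 0 because \<open>\<phi>\<^sub>n(\<rho>) \<rightarrow> 1\<close>; the geometric majorant allows the limit to be taken
  under the sum.\<close>

lemma radial_factor_quotient_tendsto:
  assumes r: "0 \<le> r" "r < 1"
  shows "((\<lambda>\<rho>. \<Sum>n. \<bar>radial_factor n r / radial_factor n \<rho> - radial_factor n r\<bar>) \<longlongrightarrow> 0) (at_left 1)"
proof -
  \<comment> \<open>Any point strictly between \<open>r\<close> and 1 yields a majorant for all \<open>\<rho>\<close> beyond it.\<close>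
  define \<sigma> where "\<sigma> = (1 + r) / 2"
  have \<sigma>: "r < \<sigma>" "\<sigma> < 1" using r by (auto simp: \<sigma>_def)
  define M where "M = (\<lambda>n. 2 * (real (Suc n) * (r / \<sigma>) ^ n))"
  have M: "summable (\<lambda>n. 2 * M n)"
    unfolding M_def by (intro summable_mult summable_radial_factor_majorant r \<sigma>)
  have 1: "((\<lambda>\<rho>. \<bar>radial_factor n r / radial_factor n \<rho> - radial_factor n r\<bar>) \<longlongrightarrow> 0) (at_left 1)" for n
  proof -
    have "((\<lambda>\<rho>. radial_factor n \<rho>) \<longlongrightarrow> radial_factor n 1) (at_left 1)"
      unfolding radial_factor_def by (intro tendsto_intros) simp_all
    then have "((\<lambda>\<rho>. \<bar>radial_factor n r / radial_factor n \<rho> - radial_factor n r\<bar>)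
        \<longlongrightarrow> \<bar>radial_factor n r / 1 - radial_factor n r\<bar>) (at_left 1)"
      unfolding radial_factor_1 by (intro tendsto_intros) auto
    then show ?thesis by simp
  qed
  have ev: "\<forall>\<^sub>F \<rho> in at_left 1. \<sigma> < \<rho> \<and> \<rho> < 1"
    using eventually_at_left_real[OF \<sigma>(2)] by eventually_elim auto
  have "norm \<bar>radial_factor n r / radial_factor n \<rho> - radial_factor n r\<bar> \<le> 2 * M n"
    if "\<sigma> < \<rho> \<and> \<rho> < 1" for n \<rho>
  proof -
    have "\<bar>radial_factor n r / radial_factor n \<rho>\<bar> \<le> M n"
      unfolding M_def using that by (intro radial_factor_quotient_bound r \<sigma>) auto
    moreover have "\<bar>radial_factor n r\<bar> \<le> M n"
      using radial_factor_quotient_bound[OF r(1) \<sigma>(1), of 1 n] \<sigma>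
      unfolding M_def radial_factor_1 by simp
    ultimately show ?thesis unfolding real_norm_def abs_idempotent by linarith
  qed
  then have "\<forall>\<^sub>F (n, \<rho>) in at_top \<times>\<^sub>F at_left 1.
      norm \<bar>radial_factor n r / radial_factor n \<rho> - radial_factor n r\<bar> \<le> 2 * M n"
    by (intro eventually_mono[OF eventually_prodI[OF eventually_True ev]]) auto
  from tannerys_theorem[OF 1 this M trivial_limit_at_left_real]
  show ?thesis by simp
qed

text \<open>The factor 3 accounts for the doubled series and the separate coefficient \<open>q\<^sub>0\<close>.\<close>

lemma cosine_kernel_diff_bound:
  assumes p: "summable (\<lambda>n. \<bar>p n\<bar>)" and q: "summable (\<lambda>n. \<bar>q n\<bar>)"
  shows "\<bar>cosine_kernel p \<theta> - cosine_kernel q \<theta>\<bar> \<le> 3 * (\<Sum>n. \<bar>p n - q n\<bar>)"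
proof -
  have d: "summable (\<lambda>n. \<bar>p n - q n\<bar>)"
    by (rule summable_comparison_test'[OF summable_add[OF p q], of 0]) auto
  have le: "\<bar>x n * cos (real n * \<theta>)\<bar> \<le> \<bar>x n\<bar>" for x :: "nat \<Rightarrow> real" and n
    by (auto simp: abs_mult intro: mult_left_le)
  have sc: "summable (\<lambda>n. x n * cos (real n * \<theta>))" if "summable (\<lambda>n. \<bar>x n\<bar>)" for x :: "nat \<Rightarrow> real"
    by (rule summable_comparison_test'[OF that, of 0]) (use le in auto)
  have sd: "summable (\<lambda>n. \<bar>(p n - q n) * cos (real n * \<theta>)\<bar>)"
    by (rule summable_comparison_test'[OF d, of 0]) (use le[of "\<lambda>n. p n - q n"] in auto)
  have "\<bar>\<Sum>n. (p n - q n) * cos (real n * \<theta>)\<bar> \<le> (\<Sum>n. \<bar>(p n - q n) * cos (real n * \<theta>)\<bar>)"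
    by (rule summable_rabs[OF sd])
  also have "\<dots> \<le> (\<Sum>n. \<bar>p n - q n\<bar>)"
    by (rule suminf_le[OF le[of "\<lambda>n. p n - q n"] sd d])
  finally have 1: "\<bar>\<Sum>n. (p n - q n) * cos (real n * \<theta>)\<bar> \<le> (\<Sum>n. \<bar>p n - q n\<bar>)" .
  have 2: "\<bar>p 0 - q 0\<bar> \<le> (\<Sum>n. \<bar>p n - q n\<bar>)"
    using sum_le_suminf[OF d, of "{0}"] by simp
  have "(\<Sum>n. (p n - q n) * cos (real n * \<theta>))
      = (\<Sum>n. p n * cos (real n * \<theta>)) - (\<Sum>n. q n * cos (real n * \<theta>))"
    unfolding left_diff_distrib by (rule suminf_diff[symmetric, OF sc[OF p] sc[OF q]])
  then have "cosine_kernel p \<theta> - cosine_kernel q \<theta>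
      = 2 * (\<Sum>n. (p n - q n) * cos (real n * \<theta>)) - (p 0 - q 0)"
    by (simp add: cosine_kernel_def)
  then show ?thesis using 1 2 by linarith
qed

lemma cosine_kernel_at_origin:
  "cosine_kernel (\<lambda>n. radial_factor n 0 / radial_factor n \<rho>) \<theta> = 1 / (1 + \<rho>\<^sup>2)"
proof -
  have "radial_factor n 0 = 0" if "n \<noteq> 0" for n using that by (simp add: radial_factor_def)
  then have "(\<Sum>n. radial_factor n 0 / radial_factor n \<rho> * cos (real n * \<theta>))
      = (\<Sum>n\<in>{0}. radial_factor n 0 / radial_factor n \<rho> * cos (real n * \<theta>))"
    by (intro suminf_finite) auto
  then show ?thesis by (simp add: cosine_kernel_def radial_factor_def)
qed

theorem theorem1:
  fixes u :: "complex \<Rightarrow> complex"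
  assumes "u \<in> unit_disk \<rightarrow> unit_disk"
    and "T_harmonic 2 u"
  shows "\<forall>z\<in>unit_disk.
    cmod (u z - of_real ((1 - (cmod z)\<^sup>2) ^ 3 / (1 + (cmod z)\<^sup>2) ^ 2) * u 0)
      \<le> 2 / pi * ((1 + (cmod z)\<^sup>2) * arctan (cmod z)
                   + cmod z * (1 - (cmod z)\<^sup>2) / (1 + (cmod z)\<^sup>2))"
proof
  fix z :: complex assume z: "z \<in> unit_disk"
  define r where "r = cmod z"
  define t where "t = Arg z"
  define k where "k = (1 - r\<^sup>2) ^ 3 / (1 + r\<^sup>2) ^ 2"
  define B where "B = (1 + r\<^sup>2) * arctan r + r * (1 - r\<^sup>2) / (1 + r\<^sup>2)"
  define I where "I = {- (pi / 2)..3 * pi / 2}"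
  define P where "P = (\<lambda>\<theta>. (1 - r\<^sup>2) ^ 3 / (2 * (1 + r\<^sup>2 - 2 * r * cos \<theta>)\<^sup>2))"
  \<comment> \<open>\<open>E \<rho>\<close> bounds the error of replacing both kernels by their limits as \<open>\<rho> \<rightarrow> 1\<close>, uniformly in \<open>\<theta>\<close>.\<close>
  define E where "E = (\<lambda>\<rho>. 3 * (\<Sum>n. \<bar>radial_factor n r / radial_factor n \<rho> - radial_factor n r\<bar>)
      + \<bar>k * (1 / (1 + \<rho>\<^sup>2)) - k / 2\<bar>)"
  have r: "0 \<le> r" "r < 1" using z by (auto simp: r_def)
  have zr: "z = of_real r * cis t"
    using rcis_cmod_Arg[of z] by (simp add: rcis_def r_def t_def)
  have u: "T2_solution u" by (rule T2_solution_of_T_harmonic[OF assms(2)])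
  have u1: "cmod (u w) \<le> 1" if "cmod w < 1" for w using assms(1) that by (force simp: Pi_iff)
  have main: "2 * pi * cmod (u z - of_real k * u 0) \<le> 4 * B + 2 * pi * E \<rho>" if \<rho>: "r < \<rho>" "\<rho> < 1" for \<rho>
  proof -
    have \<rho>0: "0 < \<rho>" using r \<rho> by simp
    define K where "K = cosine_kernel (\<lambda>n. radial_factor n r / radial_factor n \<rho>)"
    have "((\<lambda>\<theta>. of_real (K \<theta>) * u (of_real \<rho> * cis (\<theta> + t))) has_integral
       of_real (2 * pi) * u z) I"
      unfolding K_def I_def zr by (rule T2_solution_reproducing[OF u r(1) \<rho>])
    moreover have "((\<lambda>\<theta>. of_real (1 / (1 + \<rho>\<^sup>2)) * u (of_real \<rho> * cis (\<theta> + t))) has_integral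
       of_real (2 * pi) * u 0) I"
      using T2_solution_reproducing[OF u order_refl \<rho>0 \<rho>(2), of t]
      unfolding I_def cosine_kernel_at_origin by simp
    ultimately have "((\<lambda>\<theta>. of_real (K \<theta>) * u (of_real \<rho> * cis (\<theta> + t))
         - of_real k * (of_real (1 / (1 + \<rho>\<^sup>2)) * u (of_real \<rho> * cis (\<theta> + t)))) has_integral
       of_real (2 * pi) * u z - of_real k * (of_real (2 * pi) * u 0)) I"
      by (intro has_integral_diff has_integral_mult_right)
    then have int: "((\<lambda>\<theta>. of_real (K \<theta> - k * (1 / (1 + \<rho>\<^sup>2))) * u (of_real \<rho> * cis (\<theta> + t))) has_integral
       of_real (2 * pi) * (u z - of_real k * u 0)) I"
      by (simp add: algebra_simps)
    have bound: "((\<lambda>\<theta>. \<bar>P \<theta> - k / 2\<bar> + E \<rho>) has_integral (4 * B + 2 * pi * E \<rho>)) I"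
    proof -
      have "((\<lambda>\<theta>. \<bar>P \<theta> - k / 2\<bar>) has_integral 4 * B) I"
      proof -
        have "k / 2 = (1 - r\<^sup>2) ^ 3 / (2 * (1 + r\<^sup>2)\<^sup>2)" by (simp add: k_def)
        with kernel_deviation_integral[OF r] show ?thesis by (simp only: P_def B_def I_def)
      qed
      moreover have "((\<lambda>\<theta>. E \<rho>) has_integral 2 * pi * E \<rho>) I"
        using has_integral_const_real[of "E \<rho>" "- (pi / 2)" "3 * pi / 2"] by (simp add: I_def)
      ultimately show ?thesis by (rule has_integral_add)
    qed
    have pointwise: "cmod (of_real (K \<theta> - k * (1 / (1 + \<rho>\<^sup>2))) * u (of_real \<rho> * cis (\<theta> + t)))
        \<le> \<bar>P \<theta> - k / 2\<bar> + E \<rho>" for \<theta>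
    proof -
      have P: "P \<theta> = cosine_kernel (\<lambda>n. radial_factor n r) \<theta>"
        unfolding P_def by (rule cosine_kernel_radial_factor[OF r, symmetric])
      have "\<bar>K \<theta> - P \<theta>\<bar> \<le> 3 * (\<Sum>n. \<bar>radial_factor n r / radial_factor n \<rho> - radial_factor n r\<bar>)"
        unfolding K_def P
        using summable_radial_factor_quotient[of r \<rho>] summable_radial_factor_quotient[of r 1] r \<rho>
        by (intro cosine_kernel_diff_bound) (auto simp: radial_factor_1)
      then have le: "\<bar>K \<theta> - k * (1 / (1 + \<rho>\<^sup>2))\<bar> \<le> \<bar>P \<theta> - k / 2\<bar> + E \<rho>"
        unfolding E_def by linarith
      have "cmod (u (of_real \<rho> * cis (\<theta> + t))) \<le> 1" using \<rho> \<rho>0 by (intro u1) (simp add: norm_mult)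
      then have "cmod (of_real (K \<theta> - k * (1 / (1 + \<rho>\<^sup>2))) * u (of_real \<rho> * cis (\<theta> + t)))
         \<le> \<bar>K \<theta> - k * (1 / (1 + \<rho>\<^sup>2))\<bar> * 1"
        unfolding norm_mult norm_of_real by (rule mult_left_mono) simp
      with le show ?thesis by simp
    qed
    have "cmod (integral I (\<lambda>\<theta>. of_real (K \<theta> - k * (1 / (1 + \<rho>\<^sup>2))) * u (of_real \<rho> * cis (\<theta> + t))))
        \<le> integral I (\<lambda>\<theta>. \<bar>P \<theta> - k / 2\<bar> + E \<rho>)"
      by (rule integral_norm_bound_integral[OF has_integral_integrable[OF int] has_integral_integrable[OF bound] pointwise])
    then have "cmod (of_real (2 * pi) * (u z - of_real k * u 0)) \<le> 4 * B + 2 * pi * E \<rho>"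
      unfolding integral_unique[OF int] integral_unique[OF bound] .
    then show ?thesis unfolding norm_mult norm_of_real by simp
  qed
  have "(E \<longlongrightarrow> 3 * 0 + \<bar>k * (1 / (1 + 1\<^sup>2)) - k / 2\<bar>) (at_left 1)"
    unfolding E_def
    by (intro tendsto_add tendsto_mult tendsto_const radial_factor_quotient_tendsto[OF r] tendsto_rabs
        tendsto_diff tendsto_divide tendsto_power tendsto_ident_at) auto
  then have E0: "(E \<longlongrightarrow> 0) (at_left 1)" by simp
  have lim: "((\<lambda>\<rho>. 4 * B + 2 * pi * E \<rho>) \<longlongrightarrow> 4 * B + 2 * pi * 0) (at_left 1)"
    by (intro tendsto_intros E0)
  have ev: "\<forall>\<^sub>F \<rho> in at_left 1. 2 * pi * cmod (u z - of_real k * u 0) \<le> 4 * B + 2 * pi * E \<rho>"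
    using eventually_at_left_real[OF r(2)] by eventually_elim (use main in auto)
  have "2 * pi * cmod (u z - of_real k * u 0) \<le> 4 * B + 2 * pi * 0"
    by (rule tendsto_lowerbound[OF lim ev]) simp
  then have "cmod (u z - of_real k * u 0) \<le> 2 / pi * B" by (simp add: field_simps)
  then show "cmod (u z - of_real ((1 - (cmod z)\<^sup>2) ^ 3 / (1 + (cmod z)\<^sup>2) ^ 2) * u 0)
      \<le> 2 / pi * ((1 + (cmod z)\<^sup>2) * arctan (cmod z)
                   + cmod z * (1 - (cmod z)\<^sup>2) / (1 + (cmod z)\<^sup>2))"
    unfolding k_def B_def r_def .
qed

end
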